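(* Let $G$ be a complete graph with $n$ vertices and let $\mathcal{H}=\{H_x \mid x\in V(G)\}$ be a family of Cohen-Macaulay shellable graphs indexed by the vertices of $G$, at least $n-1$ of which are complete graphs, and suppose that $\alpha(H_x)=\alpha(H_y)$ for all $x,y\in V(G)$. Then the lexicographic product $G[\mathcal{H}]$ is Cohen-Macaulay.
   Context: All graphs are non-empty (at least one vertex), finite and simple. $\alpha(H)$ denotes the maximum size of an independent set of vertices of $H$. The lexicographic product $G[\mathcal{H}]$ is the graph with vertex set $\bigcup_{x\in V(G)}\{(x,y)\mid y\in V(H_x)\}$ in which $(x,y)$ and $(x',y')$ are adjacent if either $x=x'$ and $y$ is adjacent to $y'$ in $H_x$, or $x$ is adjacent to $x'$ in $G$. The independence complex $\Delta_G$ of a graph $G$ is the simplicial complex on $V(G)$ whose faces are the independent sets of vertices of $G$. A simplicial complex (not necessarily pure) is shellable if its facets can be ordered $F_1,\dots,F_m$ so that for all $1\le i<j\le m$ there exist $v\in F_j\setminus F_i$ and $\ell\in\{1,\dots,j-1\}$ with $F_j\setminus F_\ell=\{v\}$. A graph is shellable (resp. Cohen-Macaulay) if its independence complex is shellable (resp. Cohen-Macaulay, i.e. its Stanley-Reisner ring over a field $k$, fixed and arbitrary, is a Cohen-Macaulay ring). *)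

theory Defs
  imports
    "HOL-Algebra.QuotRing"
    "HOL-Algebra.Ring_Divisibility"
    "HOL-Library.Poly_Mapping"
    "HOL-Library.Extended_Nat"
    "Graph_Theory.Graph_Theory"
begin

section \<open>Graphs\<close>

text \<open>A finite simple graph is a \<^locale>\<open>pair_graph\<close>: a finite, loopless, symmetric relation
  on a finite vertex set. The null graph is excluded.\<close>

definition nonempty_graph :: "'a pair_pre_digraph \<Rightarrow> bool" where
  "nonempty_graph G \<longleftrightarrow> pair_graph G \<and> pverts G \<noteq> {}"

definition complete_graph :: "'a pair_pre_digraph \<Rightarrow> bool" where
  "complete_graph G \<longleftrightarrow> complete_digraph (card (pverts G)) (with_proj G)"

definition independent_set :: "'a pair_pre_digraph \<Rightarrow> 'a set \<Rightarrow> bool" where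
  "independent_set G S \<longleftrightarrow> S \<subseteq> pverts G \<and> (\<forall>u\<in>S. \<forall>v\<in>S. (u, v) \<notin> parcs G)"

definition independence_number :: "'a pair_pre_digraph \<Rightarrow> nat" where
  "independence_number G = Max (card ` {S. independent_set G S})"

definition lex_product ::
  "'a pair_pre_digraph \<Rightarrow> ('a \<Rightarrow> 'b pair_pre_digraph) \<Rightarrow> ('a \<times> 'b) pair_pre_digraph" where
  "lex_product G H =
    (let V = (SIGMA x : pverts G. pverts (H x)) in
     \<lparr> pverts = V,
       parcs = {((x, y), (x', y')). (x, y) \<in> V \<and> (x', y') \<in> V \<and>
                  (x = x' \<and> (y, y') \<in> parcs (H x) \<or> (x, x') \<in> parcs G)} \<rparr>)"

definition independence_complex :: "'a pair_pre_digraph \<Rightarrow> 'a set set" where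
  "independence_complex G = {S. independent_set G S}"


section \<open>Shellability\<close>

definition facets :: "'v set set \<Rightarrow> 'v set set" where
  "facets \<Delta> = {F \<in> \<Delta>. \<forall>F'\<in>\<Delta>. F \<subseteq> F' \<longrightarrow> F' = F}"

definition shellable_complex :: "'v set set \<Rightarrow> bool" where
  "shellable_complex \<Delta> \<longleftrightarrow>
    (\<exists>Fs. distinct Fs \<and> set Fs = facets \<Delta> \<and>
       (\<forall>j < length Fs. \<forall>i < j. \<exists>v \<in> Fs ! j - Fs ! i. \<exists>l < j. Fs ! j - Fs ! l = {v}))"

definition shellable_graph :: "'a pair_pre_digraph \<Rightarrow> bool" where
  "shellable_graph G \<longleftrightarrow> shellable_complex (independence_complex G)"


section \<open>Cohen--Macaulay rings\<close>

subsection \<open>Localization\<close>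

text \<open>In what follows \<open>S\<close> is a multiplicatively closed subset of the commutative ring \<open>R\<close>;
  the pair \<open>(a, s)\<close> stands for the fraction \<open>a / s\<close>.\<close>

definition fraction_rel :: "('r, 'm) ring_scheme \<Rightarrow> 'r set \<Rightarrow> ('r \<times> 'r) rel" where
  "fraction_rel R S =
    {((a, s), (b, t)). a \<in> carrier R \<and> s \<in> S \<and> b \<in> carrier R \<and> t \<in> S \<and>
       (\<exists>u\<in>S. u \<otimes>\<^bsub>R\<^esub> (t \<otimes>\<^bsub>R\<^esub> a \<ominus>\<^bsub>R\<^esub> s \<otimes>\<^bsub>R\<^esub> b) = \<zero>\<^bsub>R\<^esub>)}"

definition fraction :: "('r, 'm) ring_scheme \<Rightarrow> 'r set \<Rightarrow> 'r \<Rightarrow> 'r \<Rightarrow> ('r \<times> 'r) set" where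
  "fraction R S a s = fraction_rel R S `` {(a, s)}"

definition localization :: "('r, 'm) ring_scheme \<Rightarrow> 'r set \<Rightarrow> ('r \<times> 'r) set ring" where
  "localization R S =
    \<lparr> carrier = (carrier R \<times> S) // fraction_rel R S,
      mult = (\<lambda>X Y. \<Union>(a, s)\<in>X. \<Union>(b, t)\<in>Y. fraction R S (a \<otimes>\<^bsub>R\<^esub> b) (s \<otimes>\<^bsub>R\<^esub> t)),
      one = fraction R S \<one>\<^bsub>R\<^esub> \<one>\<^bsub>R\<^esub>,
      zero = fraction R S \<zero>\<^bsub>R\<^esub> \<one>\<^bsub>R\<^esub>,
      add = (\<lambda>X Y. \<Union>(a, s)\<in>X. \<Union>(b, t)\<in>Y.
               fraction R S (t \<otimes>\<^bsub>R\<^esub> a \<oplus>\<^bsub>R\<^esub> s \<otimes>\<^bsub>R\<^esub> b) (s \<otimes>\<^bsub>R\<^esub> t)) \<rparr>"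


subsection \<open>Dimension and depth\<close>

definition krull_dim :: "('r, 'm) ring_scheme \<Rightarrow> enat" where
  "krull_dim R = Sup {enat n | n. \<exists>P :: nat \<Rightarrow> 'r set.
     (\<forall>i\<le>n. primeideal (P i) R) \<and> (\<forall>i<n. P i \<subset> P (Suc i))}"

text \<open>The first conjunct says that \<open>xs ! i\<close> is a nonzerodivisor on \<open>R\<close> modulo the ideal generated
  by the preceding elements, the second that the quotient of \<open>R\<close> by all of them is nonzero.\<close>

definition regular_sequence :: "('r, 'm) ring_scheme \<Rightarrow> 'r list \<Rightarrow> bool" where
  "regular_sequence R xs \<longleftrightarrow>
    set xs \<subseteq> carrier R \<and>
    (\<forall>i < length xs. \<forall>a \<in> carrier R.
       xs ! i \<otimes>\<^bsub>R\<^esub> a \<in> genideal R (set (take i xs)) \<longrightarrow> a \<in> genideal R (set (take i xs))) \<and>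
    genideal R (set xs) \<noteq> carrier R"

text \<open>The depth of \<open>R\<close> in the ideal \<open>I\<close>; for a Noetherian local ring with maximal ideal \<open>M\<close>,
  the depth of the ring is \<open>ideal_depth R M\<close>.\<close>

definition ideal_depth :: "('r, 'm) ring_scheme \<Rightarrow> 'r set \<Rightarrow> enat" where
  "ideal_depth R I = Sup {enat (length xs) | xs. regular_sequence R xs \<and> set xs \<subseteq> I}"

definition cohen_macaulay_local_ring :: "('r, 'm) ring_scheme \<Rightarrow> bool" where
  "cohen_macaulay_local_ring R \<longleftrightarrow>
    cring R \<and> noetherian_ring R \<and>
    (\<exists>M. {N. maximalideal N R} = {M} \<and> ideal_depth R M = krull_dim R)"

definition cohen_macaulay_ring :: "('r, 'm) ring_scheme \<Rightarrow> bool" where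
  "cohen_macaulay_ring R \<longleftrightarrow>
    cring R \<and> noetherian_ring R \<and>
    (\<forall>M. maximalideal M R \<longrightarrow> cohen_macaulay_local_ring (localization R (carrier R - M)))"


section \<open>Stanley--Reisner rings\<close>

text \<open>The polynomial ring over the field \<open>'k\<close> in the variables \<open>V\<close>: finitely supported functions
  from monomials (exponent vectors) to coefficients, in which only variables from \<open>V\<close> occur.\<close>

definition polynomial_ring :: "'v set \<Rightarrow> (('v \<Rightarrow>\<^sub>0 nat) \<Rightarrow>\<^sub>0 'k::field) ring" where
  "polynomial_ring V =
    \<lparr> carrier = {p. \<forall>m \<in> Poly_Mapping.keys p. Poly_Mapping.keys m \<subseteq> V},
      mult = (*), one = 1, zero = 0, add = (+) \<rparr>"

definition squarefree_monomial :: "'v set \<Rightarrow> (('v \<Rightarrow>\<^sub>0 nat) \<Rightarrow>\<^sub>0 'k::field)" where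
  "squarefree_monomial F = Poly_Mapping.single (\<Sum>v\<in>F. Poly_Mapping.single v 1) 1"

definition stanley_reisner_ring ::
  "'v set \<Rightarrow> 'v set set \<Rightarrow> (('v \<Rightarrow>\<^sub>0 nat) \<Rightarrow>\<^sub>0 'k::field) set ring" where
  "stanley_reisner_ring V \<Delta> =
    polynomial_ring V Quot
      genideal (polynomial_ring V) {squarefree_monomial F | F. F \<subseteq> V \<and> F \<notin> \<Delta>}"

definition cohen_macaulay_graph :: "'k::field itself \<Rightarrow> 'a pair_pre_digraph \<Rightarrow> bool" where
  "cohen_macaulay_graph k G \<longleftrightarrow>
    cohen_macaulay_ring
      (stanley_reisner_ring (pverts G) (independence_complex G)
         :: (('a \<Rightarrow>\<^sub>0 nat) \<Rightarrow>\<^sub>0 'k) set ring)"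

end

theory Submission
  imports
    Defs
    "HOL-Computational_Algebra.Polynomial"
begin

text \<open>
  Suppose first that \<open>G\<close> has at least two vertices. Then some \<open>H x\<close> is complete, so the common
  independence number is 1, so any two distinct vertices of any \<open>H y\<close> are adjacent, and the same
  holds in the lexicographic product because \<open>G\<close> is complete. Its independence complex consists of
  isolated points. If \<open>G\<close> has a single vertex \<open>x\<close>, the product is a copy of \<open>H x\<close> whose vertices
  are renamed by \<open>y \<mapsto> (x, y)\<close>. The theorem therefore rests on two facts: the Stanley--Reisner
  ring of a nonempty finite set of isolated points is Cohen--Macaulay
  (\<open>cohen_macaulay_stanley_reisner_points\<close>), and renaming the vertices of a complex preserves
  Cohen--Macaulayness (\<open>cohen_macaulay_stanley_reisner_rename\<close>). The second follows from
  invariance under ring isomorphism, which has to be carried through localization, Krull dimension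
  and depth (\<open>cohen_macaulay_ring_iso\<close>).

  For the first fact, \<open>k[V] / (x\<^sub>u x\<^sub>v | u \<noteq> v)\<close> is the coordinate ring of the union of the
  coordinate axes: restriction to the axes identifies it with the ring of families
  \<open>(f\<^sub>v)\<close> of polynomials in one variable that share their value at the origin. This
  ring is Noetherian, as a submodule of a free module of finite rank over \<open>k[X]\<close>. Every
  maximal ideal \<open>M\<close> contains a nonzerodivisor: if the diagonal element \<open>t = (X, \<dots>, X)\<close> is not in
  \<open>M\<close>, then some \<open>1 - b t\<close> is, and all components of this element have value 1 at the origin. So
  each localization at a maximal ideal has dimension and depth at least one.

  The upper bounds both come from one elementary property: for all \<open>a\<close>, \<open>b\<close> there are \<open>n\<close>, \<open>m\<close>,
  \<open>x\<close>, \<open>y\<close> with \<open>a\<^sup>n (b\<^sup>m (1 + b y) + a x) = 0\<close>. This is the Coquand--Lombardi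
  characterization of Krull dimension at most one. The property passes to localizations, and a short
  computation shows that it also excludes regular sequences of length two
  (\<open>cohen_macaulay_ring_criterion\<close>). In the ring of the axes it holds because every
  polynomial is algebraic over \<open>k\<close> modulo any nonzero polynomial (\<open>algebraic_modulo\<close>).
\<close>

section \<open>Localization at a multiplicative set\<close>

(* The symbol is used for addition in rings. *)
no_notation vwalk_join (infixr "\<oplus>" 65)

text \<open>The operations of a localization are unions over all representatives of two classes. Such a
  union is a single class as soon as the result is independent of the representatives.\<close>

lemma UN_pairs_constant:
  assumes "\<And>a s b t. (a, s) \<in> X \<Longrightarrow> (b, t) \<in> Y \<Longrightarrow> F a s b t = C"
    and "(a0, s0) \<in> X" "(b0, t0) \<in> Y"
  shows "(\<Union>(a, s)\<in>X. \<Union>(b, t)\<in>Y. F a s b t) = C"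
proof -
  have "(\<Union>(a, s)\<in>X. \<Union>(b, t)\<in>Y. F a s b t) = (\<Union>p\<in>X. \<Union>q\<in>Y. C)"
    using assms(1) by (intro SUP_cong refl) auto
  also have "\<dots> = C" using assms(2,3) by auto
  finally show ?thesis .
qed

locale multiplicative_set = cring R for R (structure) +
  fixes S
  assumes S_carr: "S \<subseteq> carrier R" and one_S: "\<one> \<in> S"
    and mult_S: "s \<in> S \<Longrightarrow> t \<in> S \<Longrightarrow> s \<otimes> t \<in> S"
begin

abbreviation frac where "frac a s \<equiv> fraction R S a s"
abbreviation L where "L \<equiv> localization R S"

lemma S_closed [simp]: "s \<in> S \<Longrightarrow> s \<in> carrier R"
  using S_carr by auto

text \<open>Without the subtraction, equality of fractions is an identity between products, which can be
  handled by associativity and commutativity alone.\<close>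

lemma fraction_condition:
  assumes "a \<in> carrier R" "s \<in> S" "b \<in> carrier R" "t \<in> S" "u \<in> S"
  shows "u \<otimes> (t \<otimes> a \<ominus> s \<otimes> b) = \<zero> \<longleftrightarrow> u \<otimes> (t \<otimes> a) = u \<otimes> (s \<otimes> b)"
proof -
  have "u \<otimes> (t \<otimes> a \<ominus> s \<otimes> b) = u \<otimes> (t \<otimes> a) \<ominus> u \<otimes> (s \<otimes> b)"
    using assms by (simp add: minus_eq r_distr r_minus)
  then show ?thesis using assms by (simp add: r_right_minus_eq)
qed

lemma fraction_rel_iff:
  "((a, s), (b, t)) \<in> fraction_rel R S \<longleftrightarrow>
    a \<in> carrier R \<and> s \<in> S \<and> b \<in> carrier R \<and> t \<in> S \<and> (\<exists>u\<in>S. u \<otimes> (t \<otimes> a) = u \<otimes> (s \<otimes> b))"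
  using fraction_condition by (simp add: fraction_rel_def cong: conj_cong bex_cong)

lemma equiv_fraction_rel: "equiv (carrier R \<times> S) (fraction_rel R S)"
proof (rule equivI)
  show "fraction_rel R S \<subseteq> (carrier R \<times> S) \<times> (carrier R \<times> S)"
    by (auto simp: fraction_rel_def)
  show "refl_on (carrier R \<times> S) (fraction_rel R S)"
    using one_S by (auto simp: refl_on_def fraction_rel_iff)
  show "sym (fraction_rel R S)"
    by (rule symI) (clarsimp simp: fraction_rel_iff, metis)
  show "trans (fraction_rel R S)"
  proof (rule transI, clarsimp simp: fraction_rel_iff)
    fix a s b t c r u v
    assume *: "a \<in> carrier R" "s \<in> S" "b \<in> carrier R" "t \<in> S" "c \<in> carrier R" "r \<in> S"
        "u \<in> S" "v \<in> S"
      and eq: "u \<otimes> (t \<otimes> a) = u \<otimes> (s \<otimes> b)" "v \<otimes> (r \<otimes> b) = v \<otimes> (t \<otimes> c)"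
    have "(u \<otimes> v \<otimes> t) \<otimes> (r \<otimes> a) = (r \<otimes> v) \<otimes> (u \<otimes> (t \<otimes> a))"
      using * by (simp add: m_ac)
    also have "\<dots> = (s \<otimes> u) \<otimes> (v \<otimes> (r \<otimes> b))"
      unfolding eq(1) using * by (simp add: m_ac)
    also have "\<dots> = (u \<otimes> v \<otimes> t) \<otimes> (s \<otimes> c)"
      unfolding eq(2) using * by (simp add: m_ac)
    (* u and v witness a/s = b/t and b/t = c/r; the product u v t witnesses a/s = c/r. *)
    finally show "\<exists>u\<in>S. u \<otimes> (r \<otimes> a) = u \<otimes> (s \<otimes> c)"
      using * mult_S by blast
  qed
qed

lemma frac_eq_iff:
  assumes "a \<in> carrier R" "s \<in> S" "b \<in> carrier R" "t \<in> S"
  shows "frac a s = frac b t \<longleftrightarrow> (\<exists>u\<in>S. u \<otimes> (t \<otimes> a) = u \<otimes> (s \<otimes> b))"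
  using eq_equiv_class_iff[OF equiv_fraction_rel, of "(a, s)" "(b, t)"] assms
  by (simp add: fraction_def fraction_rel_iff)

lemma frac_eqI:
  assumes "a \<in> carrier R" "s \<in> S" "b \<in> carrier R" "t \<in> S" "t \<otimes> a = s \<otimes> b"
  shows "frac a s = frac b t"
  using assms frac_eq_iff one_S by metis

lemma mem_frac_iff:
  "(b, t) \<in> frac a s \<longleftrightarrow> ((a, s), (b, t)) \<in> fraction_rel R S"
  by (simp add: fraction_def)

lemma mem_fracD:
  assumes "a \<in> carrier R" "s \<in> S" "(b, t) \<in> frac a s"
  shows "b \<in> carrier R" "t \<in> S" "frac b t = frac a s"
  using assms frac_eq_iff[of a s b t]
  unfolding mem_frac_iff fraction_rel_iff by blast+

lemma frac_self: "a \<in> carrier R \<Longrightarrow> s \<in> S \<Longrightarrow> (a, s) \<in> frac a s"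
  using equiv_class_self[OF equiv_fraction_rel] by (auto simp: fraction_def)

lemma carrier_localization: "carrier L = {frac a s | a s. a \<in> carrier R \<and> s \<in> S}"
  by (auto simp: localization_def quotient_def fraction_def)

lemma frac_closed [simp]: "a \<in> carrier R \<Longrightarrow> s \<in> S \<Longrightarrow> frac a s \<in> carrier L"
  by (auto simp: carrier_localization)

lemma localizationE:
  assumes "X \<in> carrier L"
  obtains a s where "a \<in> carrier R" "s \<in> S" "X = frac a s"
  using assms by (auto simp: carrier_localization)

text \<open>If \<open>u\<close> and \<open>v\<close> witness that the representatives of the two factors are changed within their
  classes, then \<open>u \<otimes> v\<close> witnesses the same for the product. The sum is treated alike.\<close>

lemma mult_frac:
  assumes "a \<in> carrier R" "s \<in> S" "b \<in> carrier R" "t \<in> S"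
  shows "frac a s \<otimes>\<^bsub>L\<^esub> frac b t = frac (a \<otimes> b) (s \<otimes> t)"
proof -
  have "frac (a' \<otimes> b') (s' \<otimes> t') = frac (a \<otimes> b) (s \<otimes> t)"
    if "(a', s') \<in> frac a s" "(b', t') \<in> frac b t" for a' s' b' t'
  proof -
    have c: "a' \<in> carrier R" "s' \<in> S" "b' \<in> carrier R" "t' \<in> S"
      and e: "frac a' s' = frac a s" "frac b' t' = frac b t"
      using mem_fracD[OF assms(1,2) that(1)] mem_fracD[OF assms(3,4) that(2)] by simp_all
    then obtain u v where uv: "u \<in> S" "v \<in> S" "u \<otimes> (s \<otimes> a') = u \<otimes> (s' \<otimes> a)"
      "v \<otimes> (t \<otimes> b') = v \<otimes> (t' \<otimes> b)"
      using e frac_eq_iff[OF c(1,2) assms(1,2)] frac_eq_iff[OF c(3,4) assms(3,4)] by blast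
    have "(u \<otimes> v) \<otimes> ((s \<otimes> t) \<otimes> (a' \<otimes> b')) = (u \<otimes> (s \<otimes> a')) \<otimes> (v \<otimes> (t \<otimes> b'))"
      using assms c uv(1,2) by (simp add: m_ac)
    also have "\<dots> = (u \<otimes> v) \<otimes> ((s' \<otimes> t') \<otimes> (a \<otimes> b))"
      unfolding uv using assms c uv(1,2) by (simp add: m_ac)
    finally have eq: "\<exists>w\<in>S. w \<otimes> ((s \<otimes> t) \<otimes> (a' \<otimes> b')) = w \<otimes> ((s' \<otimes> t') \<otimes> (a \<otimes> b))"
      using mult_S[OF uv(1,2)] by blast
    have "a' \<otimes> b' \<in> carrier R" "a \<otimes> b \<in> carrier R" "s' \<otimes> t' \<in> S" "s \<otimes> t \<in> S"
      using assms c mult_S by simp_all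
    then show ?thesis using eq by (simp only: frac_eq_iff)
  qed
  then show ?thesis
    unfolding localization_def
    by (simp add: UN_pairs_constant[OF _ frac_self[OF assms(1,2)] frac_self[OF assms(3,4)]])
qed

lemma add_frac:
  assumes "a \<in> carrier R" "s \<in> S" "b \<in> carrier R" "t \<in> S"
  shows "frac a s \<oplus>\<^bsub>L\<^esub> frac b t = frac (t \<otimes> a \<oplus> s \<otimes> b) (s \<otimes> t)"
proof -
  have "frac (t' \<otimes> a' \<oplus> s' \<otimes> b') (s' \<otimes> t') = frac (t \<otimes> a \<oplus> s \<otimes> b) (s \<otimes> t)"
    if "(a', s') \<in> frac a s" "(b', t') \<in> frac b t" for a' s' b' t'
  proof -
    have c: "a' \<in> carrier R" "s' \<in> S" "b' \<in> carrier R" "t' \<in> S"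
      and e: "frac a' s' = frac a s" "frac b' t' = frac b t"
      using mem_fracD[OF assms(1,2) that(1)] mem_fracD[OF assms(3,4) that(2)] by simp_all
    then obtain u v where uv: "u \<in> S" "v \<in> S" "u \<otimes> (s \<otimes> a') = u \<otimes> (s' \<otimes> a)"
      "v \<otimes> (t \<otimes> b') = v \<otimes> (t' \<otimes> b)"
      using e frac_eq_iff[OF c(1,2) assms(1,2)] frac_eq_iff[OF c(3,4) assms(3,4)] by blast
    have "(u \<otimes> v) \<otimes> ((s \<otimes> t) \<otimes> (t' \<otimes> a' \<oplus> s' \<otimes> b')) =
        v \<otimes> t \<otimes> t' \<otimes> (u \<otimes> (s \<otimes> a')) \<oplus> u \<otimes> s \<otimes> s' \<otimes> (v \<otimes> (t \<otimes> b'))"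
      using assms c uv(1,2) by (simp add: r_distr m_ac)
    also have "\<dots> = (u \<otimes> v) \<otimes> ((s' \<otimes> t') \<otimes> (t \<otimes> a \<oplus> s \<otimes> b))"
      unfolding uv using assms c uv(1,2) by (simp add: r_distr m_ac)
    finally have eq: "\<exists>w\<in>S. w \<otimes> ((s \<otimes> t) \<otimes> (t' \<otimes> a' \<oplus> s' \<otimes> b')) =
        w \<otimes> ((s' \<otimes> t') \<otimes> (t \<otimes> a \<oplus> s \<otimes> b))"
      using mult_S[OF uv(1,2)] by blast
    have "t' \<otimes> a' \<oplus> s' \<otimes> b' \<in> carrier R" "t \<otimes> a \<oplus> s \<otimes> b \<in> carrier R"
      "s' \<otimes> t' \<in> S" "s \<otimes> t \<in> S"
      using assms c mult_S by simp_all
    then show ?thesis using eq by (simp only: frac_eq_iff)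
  qed
  then show ?thesis
    unfolding localization_def
    by (simp add: UN_pairs_constant[OF _ frac_self[OF assms(1,2)] frac_self[OF assms(3,4)]])
qed

lemma one_localization: "\<one>\<^bsub>L\<^esub> = frac \<one> \<one>"
  and zero_localization: "\<zero>\<^bsub>L\<^esub> = frac \<zero> \<one>"
  by (simp_all add: localization_def)

lemma frac_eq_zero_iff:
  assumes "a \<in> carrier R" "s \<in> S"
  shows "frac a s = \<zero>\<^bsub>L\<^esub> \<longleftrightarrow> (\<exists>u\<in>S. u \<otimes> a = \<zero>)"
  using assms one_S by (simp add: zero_localization frac_eq_iff)

lemma frac_uminus_add:
  assumes "a \<in> carrier R" "s \<in> S"
  shows "frac (\<ominus> a) s \<oplus>\<^bsub>L\<^esub> frac a s = \<zero>\<^bsub>L\<^esub>"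
proof -
  have "frac (s \<otimes> (\<ominus> a) \<oplus> s \<otimes> a) (s \<otimes> s) = frac \<zero> \<one>"
    by (rule frac_eqI) (use assms one_S mult_S in \<open>simp_all add: l_neg r_minus\<close>)
  then show ?thesis using assms by (simp add: zero_localization add_frac)
qed

lemma cring_localization: "cring L"
proof (rule cringI)
  show "abelian_group L"
  proof (rule abelian_groupI; (elim localizationE)?)
    show "\<zero>\<^bsub>L\<^esub> \<in> carrier L" by (simp add: zero_localization one_S)
  next
    fix X a s assume *: "a \<in> carrier R" "s \<in> S" "X = frac a s"
    show "\<zero>\<^bsub>L\<^esub> \<oplus>\<^bsub>L\<^esub> X = X"
      using * one_S by (simp add: zero_localization add_frac)
    show "\<exists>Y\<in>carrier L. Y \<oplus>\<^bsub>L\<^esub> X = \<zero>\<^bsub>L\<^esub>"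
      using * frac_uminus_add[OF *(1,2)] by (auto intro!: bexI[of _ "frac (\<ominus> a) s"])
  next
    fix X Y a s b t assume *: "a \<in> carrier R" "s \<in> S" "X = frac a s" "b \<in> carrier R" "t \<in> S" "Y = frac b t"
    then show "X \<oplus>\<^bsub>L\<^esub> Y \<in> carrier L" by (simp add: add_frac mult_S)
    show "X \<oplus>\<^bsub>L\<^esub> Y = Y \<oplus>\<^bsub>L\<^esub> X" using * by (simp add: add_frac m_comm a_comm)
  next
    fix X Y Z a s b t c r
    assume *: "a \<in> carrier R" "s \<in> S" "X = frac a s" "b \<in> carrier R" "t \<in> S" "Y = frac b t"
      "c \<in> carrier R" "r \<in> S" "Z = frac c r"
    then have cc: "s \<in> carrier R" "t \<in> carrier R" "r \<in> carrier R" by auto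
    have "r \<otimes> (t \<otimes> a \<oplus> s \<otimes> b) \<oplus> (s \<otimes> t) \<otimes> c = (t \<otimes> r) \<otimes> a \<oplus> s \<otimes> (r \<otimes> b \<oplus> t \<otimes> c)"
      using *(1,4,7) cc by (simp add: l_distr r_distr m_ac a_ac)
    then show "X \<oplus>\<^bsub>L\<^esub> Y \<oplus>\<^bsub>L\<^esub> Z = X \<oplus>\<^bsub>L\<^esub> (Y \<oplus>\<^bsub>L\<^esub> Z)"
      using * by (simp add: add_frac mult_S m_assoc)
  qed
next
  show "comm_monoid L"
  proof (rule comm_monoidI; (elim localizationE)?)
    show "\<one>\<^bsub>L\<^esub> \<in> carrier L" by (simp add: one_localization one_S)
  next
    fix X a s assume *: "a \<in> carrier R" "s \<in> S" "X = frac a s"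
    show "\<one>\<^bsub>L\<^esub> \<otimes>\<^bsub>L\<^esub> X = X"
      using * one_S by (simp add: one_localization mult_frac)
  next
    fix X Y a s b t assume *: "a \<in> carrier R" "s \<in> S" "X = frac a s" "b \<in> carrier R" "t \<in> S" "Y = frac b t"
    then show "X \<otimes>\<^bsub>L\<^esub> Y \<in> carrier L" by (simp add: mult_frac mult_S)
    show "X \<otimes>\<^bsub>L\<^esub> Y = Y \<otimes>\<^bsub>L\<^esub> X" using * by (simp add: mult_frac m_comm)
  next
    fix X Y Z a s b t c r
    assume *: "a \<in> carrier R" "s \<in> S" "X = frac a s" "b \<in> carrier R" "t \<in> S" "Y = frac b t"
      "c \<in> carrier R" "r \<in> S" "Z = frac c r"
    then show "X \<otimes>\<^bsub>L\<^esub> Y \<otimes>\<^bsub>L\<^esub> Z = X \<otimes>\<^bsub>L\<^esub> (Y \<otimes>\<^bsub>L\<^esub> Z)"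
      by (simp add: mult_frac mult_S m_assoc)
  qed
next
  fix X Y Z assume "X \<in> carrier L" "Y \<in> carrier L" "Z \<in> carrier L"
  then obtain a s b t c r where *: "a \<in> carrier R" "s \<in> S" "X = frac a s" "b \<in> carrier R" "t \<in> S" "Y = frac b t"
      "c \<in> carrier R" "r \<in> S" "Z = frac c r"
    by (elim localizationE) blast
  then have cc: "s \<in> carrier R" "t \<in> carrier R" "r \<in> carrier R" by auto
  have "frac ((t \<otimes> a \<oplus> s \<otimes> b) \<otimes> c) (s \<otimes> t \<otimes> r) =
      frac (t \<otimes> r \<otimes> (a \<otimes> c) \<oplus> s \<otimes> r \<otimes> (b \<otimes> c)) (s \<otimes> r \<otimes> (t \<otimes> r))"
  proof (rule frac_eqI)
    show "s \<otimes> r \<otimes> (t \<otimes> r) \<otimes> ((t \<otimes> a \<oplus> s \<otimes> b) \<otimes> c) =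
        s \<otimes> t \<otimes> r \<otimes> (t \<otimes> r \<otimes> (a \<otimes> c) \<oplus> s \<otimes> r \<otimes> (b \<otimes> c))"
      using *(1,4,7) cc by (simp add: l_distr r_distr m_ac)
  qed (use * mult_S in auto)
  then show "(X \<oplus>\<^bsub>L\<^esub> Y) \<otimes>\<^bsub>L\<^esub> Z = X \<otimes>\<^bsub>L\<^esub> Z \<oplus>\<^bsub>L\<^esub> Y \<otimes>\<^bsub>L\<^esub> Z"
    using * by (simp add: add_frac mult_frac mult_S)
qed

sublocale L: cring L by (rule cring_localization)

lemma frac_one_hom: "(\<lambda>a. frac a \<one>) \<in> ring_hom R L"
  by (rule ring_hom_memI) (simp_all add: one_S mult_frac add_frac one_localization)

lemma ring_hom_ring_frac_one: "ring_hom_ring R L (\<lambda>a. frac a \<one>)"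
  by (rule ring_hom_ringI2) (simp_all add: frac_one_hom ring_axioms L.ring_axioms)

lemma frac_eq_mult:
  assumes "a \<in> carrier R" "s \<in> S"
  shows "frac a s = frac \<one> s \<otimes>\<^bsub>L\<^esub> frac a \<one>"
  using assms one_S by (simp add: mult_frac)

lemma frac_inverse:
  assumes "s \<in> S" "t \<in> S"
  shows "frac s t \<otimes>\<^bsub>L\<^esub> frac t s = \<one>\<^bsub>L\<^esub>"
proof -
  have "frac (s \<otimes> t) (t \<otimes> s) = frac \<one> \<one>"
    by (rule frac_eqI) (use assms one_S mult_S m_comm in \<open>simp_all\<close>)
  then show ?thesis using assms by (simp add: mult_frac one_localization)
qed

text \<open>An ideal \<open>J\<close> of the localization is generated by the image of its contraction to \<open>R\<close>: if
  \<open>a / s\<close> lies in \<open>J\<close>, then so does \<open>a / 1\<close>, and \<open>a / s\<close> is the multiple of \<open>a / 1\<close> by \<open>1 / s\<close>.\<close>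

lemma noetherian_localization:
  assumes "noetherian_ring R"
  shows "noetherian_ring L"
proof (rule L.noetherian_ringI)
  interpret \<phi>: ring_hom_ring R L "\<lambda>a. frac a \<one>" by (rule ring_hom_ring_frac_one)
  fix J assume J: "ideal J L"
  then interpret J: ideal J L .
  let ?J0 = "{a \<in> carrier R. frac a \<one> \<in> J}"
  have J0: "ideal ?J0 R" using \<phi>.ideal_vimage[OF J] .
  then obtain A where A: "A \<subseteq> carrier R" "finite A" "?J0 = Idl A"
    using noetherian_ring.finetely_gen[OF assms J0] by blast
  let ?B = "(\<lambda>a. frac a \<one>) ` A"
  have BL: "?B \<subseteq> carrier L" using A one_S by auto
  have AJ: "A \<subseteq> ?J0" using genideal_self[OF A(1)] A(3) by auto
  have "J = Idl\<^bsub>L\<^esub> ?B"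
  proof
    show "Idl\<^bsub>L\<^esub> ?B \<subseteq> J" by (rule L.genideal_minimal[OF J]) (use AJ in blast)
    show "J \<subseteq> Idl\<^bsub>L\<^esub> ?B"
    proof
      fix X assume X: "X \<in> J"
      obtain a s where as: "a \<in> carrier R" "s \<in> S" "X = frac a s"
        by (rule localizationE[OF J.Icarr[OF X]])
      have "frac a \<one> = frac s \<one> \<otimes>\<^bsub>L\<^esub> frac a s"
        using as one_S by (simp add: mult_frac) (rule frac_eqI; simp add: m_ac)
      then have "frac a \<one> \<in> J"
        using X as one_S by (metis J.I_l_closed frac_closed S_closed)
      then have "a \<in> Idl A" using A as by auto
      moreover have "Idl A \<subseteq> {a \<in> carrier R. frac a \<one> \<in> Idl\<^bsub>L\<^esub> ?B}"
        using \<phi>.ideal_vimage[OF L.genideal_ideal[OF BL]] L.genideal_self[OF BL] A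
        by (intro genideal_minimal) auto
      ultimately have "frac a \<one> \<in> Idl\<^bsub>L\<^esub> ?B" by auto
      then show "X \<in> Idl\<^bsub>L\<^esub> ?B"
        unfolding as(3) frac_eq_mult[OF as(1,2)]
        by (rule ideal.I_l_closed[OF L.genideal_ideal[OF BL]]) (use as in simp)
    qed
  qed
  then show "\<exists>A\<subseteq>carrier L. finite A \<and> J = Idl\<^bsub>L\<^esub> A" using BL A by blast
qed

end

lemma (in cring) multiplicative_set_prime:
  assumes "primeideal P R"
  shows "multiplicative_set R (carrier R - P)"
proof -
  interpret P: primeideal P R by fact
  show ?thesis
    using P.I_notcarr P.one_imp_carrier P.I_prime by unfold_locales auto
qed

text \<open>A fraction whose numerator lies outside \<open>P\<close> is invertible, so every proper ideal consists of
  fractions with numerator in \<open>P\<close>.\<close>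

lemma (in cring) maximalideals_localization:
  assumes "primeideal P R"
  shows "{N. maximalideal N (localization R (carrier R - P))} =
      {{fraction R (carrier R - P) a s | a s. a \<in> P \<and> s \<in> carrier R - P}}" (is "_ = {?M}")
proof -
  interpret P: primeideal P R by fact
  interpret multiplicative_set R "carrier R - P" by (rule multiplicative_set_prime) fact
  (* Primality of P makes this condition independent of the representative. *)
  have mem: "frac a s \<in> ?M \<longleftrightarrow> a \<in> P" if as: "a \<in> carrier R" "s \<in> carrier R - P" for a s
  proof
    assume "frac a s \<in> ?M"
    then obtain b t where b: "b \<in> P" "t \<in> carrier R - P" "frac a s = frac b t" by auto
    with as obtain u where u: "u \<in> carrier R - P" "u \<otimes> (t \<otimes> a) = u \<otimes> (s \<otimes> b)"
      using frac_eq_iff P.Icarr by metis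
    then have "u \<otimes> (t \<otimes> a) \<in> P"
      using P.I_l_closed[of "s \<otimes> b" u] P.I_l_closed[of b s] as b by auto
    then show "a \<in> P"
      using P.I_prime[of u "t \<otimes> a"] P.I_prime[of t a] u as b by auto
  next
    assume "a \<in> P" then show "frac a s \<in> ?M" using as by auto
  qed
  have M: "ideal ?M L"
  proof (rule idealI[OF L.ring_axioms])
    show "subgroup ?M (add_monoid L)"
    proof (rule L.add.subgroupI)
      show "?M \<subseteq> carrier L" using P.Icarr by auto
      show "?M \<noteq> {}" using P.zero_closed one_S by blast
    next
      fix X assume "X \<in> ?M"
      then obtain a s where *: "a \<in> P" "s \<in> carrier R - P" "X = frac a s" by auto
      have "\<ominus>\<^bsub>L\<^esub> X = frac (\<ominus> a) s"
      proof (rule L.minus_equality)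
        show "frac (\<ominus> a) s \<oplus>\<^bsub>L\<^esub> X = \<zero>\<^bsub>L\<^esub>"
          using * frac_uminus_add[of a s] P.Icarr by simp
      qed (use * P.Icarr in auto)
      then show "\<ominus>\<^bsub>L\<^esub> X \<in> ?M" using * by auto
    next
      fix X Y assume "X \<in> ?M" "Y \<in> ?M"
      then obtain a s b t where *: "a \<in> P" "s \<in> carrier R - P" "X = frac a s"
        "b \<in> P" "t \<in> carrier R - P" "Y = frac b t" by auto
      have "t \<otimes> a \<oplus> s \<otimes> b \<in> P" using * P.I_l_closed by auto
      moreover have "s \<otimes> t \<in> carrier R - P" using * mult_S by blast
      ultimately have "frac (t \<otimes> a \<oplus> s \<otimes> b) (s \<otimes> t) \<in> ?M" by blast
      then show "X \<oplus>\<^bsub>L\<^esub> Y \<in> ?M"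
        unfolding *(3,6) using * P.Icarr by (simp only: add_frac)
    qed
  next
    fix X Y assume "X \<in> ?M" "Y \<in> carrier L"
    then obtain a s b t where *: "a \<in> P" "s \<in> carrier R - P" "X = frac a s"
      "b \<in> carrier R" "t \<in> carrier R - P" "Y = frac b t" by (auto elim!: localizationE)
    then have "b \<otimes> a \<in> P" "a \<otimes> b \<in> P" "t \<otimes> s \<in> carrier R - P" "s \<otimes> t \<in> carrier R - P"
      using mult_S P.I_l_closed P.I_r_closed by blast+
    then have "frac (b \<otimes> a) (t \<otimes> s) \<in> ?M" "frac (a \<otimes> b) (s \<otimes> t) \<in> ?M" by blast+
    then show "Y \<otimes>\<^bsub>L\<^esub> X \<in> ?M" "X \<otimes>\<^bsub>L\<^esub> Y \<in> ?M"
      unfolding *(3,6) using * P.Icarr by (simp_all only: mult_frac)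
  qed
  have below: "J \<subseteq> ?M" if J: "ideal J L" "J \<noteq> carrier L" for J
  proof
    interpret J: ideal J L by fact
    fix X assume X: "X \<in> J"
    obtain a s where as: "a \<in> carrier R" "s \<in> carrier R - P" "X = frac a s"
      by (rule localizationE[OF J.Icarr[OF X]])
    show "X \<in> ?M"
    proof (rule ccontr)
      assume "X \<notin> ?M"
      then have a: "a \<in> carrier R - P" using as(1) unfolding as(3) mem[OF as(1,2)] by blast
      have "X \<otimes>\<^bsub>L\<^esub> frac s a \<in> J"
        by (rule J.I_r_closed[OF X frac_closed]) (use as(2) a in blast)+
      then have "\<one>\<^bsub>L\<^esub> \<in> J" unfolding as(3) frac_inverse[OF a as(2)] .
      then show False using J.one_imp_carrier J(2) by simp
    qed
  qed
  have "\<one>\<^bsub>L\<^esub> \<notin> ?M"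
    unfolding one_localization mem[OF one_closed one_S] using one_S by blast
  then have proper: "carrier L \<noteq> ?M" using L.one_closed by metis
  have "N = ?M" if "maximalideal N L" for N
  proof -
    interpret N: maximalideal N L by fact
    have "N \<subseteq> ?M" using below N.is_ideal N.I_notcarr by simp
    then have "?M = N" using N.I_maximal[OF M] proper ideal.Icarr[OF M] by blast
    then show "N = ?M" by simp
  qed
  moreover have "maximalideal ?M L"
    using M proper below by (intro maximalidealI) blast+
  ultimately show ?thesis by blast
qed

section \<open>Invariance under ring isomorphism\<close>

lemma ideal_subset_carrier: "ideal I R \<Longrightarrow> I \<subseteq> carrier R"
  using ideal.Icarr by (rule subsetI)

lemma primeideal_subset_carrier: "primeideal P R \<Longrightarrow> P \<subseteq> carrier R"
  by (intro ideal_subset_carrier primeideal.axioms(1))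

lemma maximalideal_subset_carrier: "maximalideal M R \<Longrightarrow> M \<subseteq> carrier R"
  by (intro ideal_subset_carrier maximalideal.axioms(1))

locale cring_iso = R: cring R + S: cring S for R (structure) and S (structure) +
  fixes h
  assumes iso: "h \<in> ring_iso R S"
begin

abbreviation h_inv where "h_inv \<equiv> inv_into (carrier R) h"

text \<open>With the inverse at hand, every statement below that compares \<open>R\<close> and \<open>S\<close> needs a proof in
  one direction only.\<close>

lemma inverse_iso: "cring_iso S R h_inv"
  by (intro cring_iso.intro cring_iso_axioms.intro S.is_cring R.is_cring
      ring_iso_set_sym R.ring_axioms iso)

sublocale hom: ring_hom_ring R S h
  by (rule ring_hom_ringI2) (use iso in \<open>auto simp: ring_iso_def R.ring_axioms S.ring_axioms\<close>)

lemma bij: "bij_betw h (carrier R) (carrier S)"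
  using iso by (simp add: ring_iso_def)

lemma h_eq_iff: "a \<in> carrier R \<Longrightarrow> b \<in> carrier R \<Longrightarrow> h a = h b \<longleftrightarrow> a = b"
  using bij by (auto simp: bij_betw_def inj_on_def)

lemma image_carrier: "h ` carrier R = carrier S"
  using bij by (simp add: bij_betw_def)

lemma h_inv_h: "a \<in> carrier R \<Longrightarrow> h_inv (h a) = a"
  using bij by (simp add: bij_betw_inv_into_left)

lemma h_h_inv: "b \<in> carrier S \<Longrightarrow> h (h_inv b) = b"
  using bij by (simp add: bij_betw_inv_into_right)

lemma vimage_inverse: "I \<subseteq> carrier R \<Longrightarrow> {b \<in> carrier S. h_inv b \<in> I} = h ` I"
  by (force simp: h_inv_h h_h_inv subset_iff image_iff)

lemma mem_image_iff: "I \<subseteq> carrier R \<Longrightarrow> a \<in> carrier R \<Longrightarrow> h a \<in> h ` I \<longleftrightarrow> a \<in> I"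
  using h_eq_iff by (auto simp: image_iff subset_iff)

lemma image_eq_iff: "I \<subseteq> carrier R \<Longrightarrow> J \<subseteq> carrier R \<Longrightarrow> h ` I = h ` J \<longleftrightarrow> I = J"
  using bij inj_on_image_eq_iff unfolding bij_betw_def by metis

lemma image_psubset:
  assumes "I \<subset> J" "J \<subseteq> carrier R"
  shows "h ` I \<subset> h ` J"
proof -
  have "h ` I \<noteq> h ` J" using assms image_eq_iff[of I J] by blast
  then show ?thesis using assms by blast
qed

lemma ideal_image:
  assumes "ideal I R"
  shows "ideal (h ` I) S"
proof -
  interpret inv: cring_iso S R h_inv by (rule inverse_iso)
  show ?thesis
    using inv.hom.ideal_vimage[OF assms] by (simp add: vimage_inverse ideal_subset_carrier[OF assms])
qed

lemma primeideal_image: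
  assumes "primeideal P R"
  shows "primeideal (h ` P) S"
proof -
  interpret inv: cring_iso S R h_inv by (rule inverse_iso)
  show ?thesis
    using inv.hom.primeideal_vimage[OF S.is_cring assms]
    by (simp add: vimage_inverse primeideal_subset_carrier[OF assms])
qed

lemma maximalideal_image:
  assumes "maximalideal M R"
  shows "maximalideal (h ` M) S"
proof (rule maximalidealI)
  interpret M: maximalideal M R by fact
  have MR: "M \<subseteq> carrier R" by (rule ideal_subset_carrier) (rule M.is_ideal)
  show "ideal (h ` M) S" by (rule ideal_image) (rule M.is_ideal)
  show "carrier S \<noteq> h ` M"
    using M.I_notcarr image_eq_iff[OF subset_refl MR] image_carrier by simp
  fix J assume J: "ideal J S" "h ` M \<subseteq> J" "J \<subseteq> carrier S"
  let ?K = "{a \<in> carrier R. h a \<in> J}"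
  have "ideal ?K R" by (rule hom.ideal_vimage[OF J(1)])
  then have "?K = M \<or> ?K = carrier R"
    using M.I_maximal[of ?K] MR J(2) by auto
  moreover have "J = h ` ?K" using J(3) image_carrier by auto
  ultimately show "J = h ` M \<or> J = carrier S" using image_carrier by auto
qed

lemma genideal_image:
  assumes A: "A \<subseteq> carrier R"
  shows "Idl\<^bsub>S\<^esub> (h ` A) = h ` (Idl\<^bsub>R\<^esub> A)"
proof
  have hA: "h ` A \<subseteq> carrier S" using A by auto
  show "Idl\<^bsub>S\<^esub> (h ` A) \<subseteq> h ` (Idl\<^bsub>R\<^esub> A)"
    by (rule S.genideal_minimal)
      (use ideal_image R.genideal_ideal[OF A] R.genideal_self[OF A] in auto)
  have "Idl\<^bsub>R\<^esub> A \<subseteq> {a \<in> carrier R. h a \<in> Idl\<^bsub>S\<^esub> (h ` A)}"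
    using hom.ideal_vimage[OF S.genideal_ideal[OF hA]] S.genideal_self[OF hA] A
    by (intro R.genideal_minimal) auto
  then show "h ` (Idl\<^bsub>R\<^esub> A) \<subseteq> Idl\<^bsub>S\<^esub> (h ` A)" by auto
qed

lemma noetherian_image:
  assumes "noetherian_ring R"
  shows "noetherian_ring S"
proof (rule S.noetherian_ringI)
  fix J assume J: "ideal J S"
  let ?K = "{a \<in> carrier R. h a \<in> J}"
  have "ideal ?K R" by (rule hom.ideal_vimage[OF J])
  then obtain A where A: "A \<subseteq> carrier R" "finite A" "?K = Idl\<^bsub>R\<^esub> A"
    using noetherian_ring.finetely_gen[OF assms] by blast
  have "J \<subseteq> carrier S" by (rule ideal_subset_carrier) fact
  then have "J = h ` ?K" unfolding image_carrier[symmetric] by auto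
  also have "\<dots> = Idl\<^bsub>S\<^esub> (h ` A)" using genideal_image[OF A(1)] A(3) by simp
  finally have "J = Idl\<^bsub>S\<^esub> (h ` A)" .
  moreover have "h ` A \<subseteq> carrier S" "finite (h ` A)" using A(1,2) by auto
  ultimately show "\<exists>A\<subseteq>carrier S. finite A \<and> J = Idl\<^bsub>S\<^esub> A" by (intro exI[of _ "h ` A"] conjI)
qed

lemma krull_dim_le: "krull_dim R \<le> krull_dim S"
  unfolding krull_dim_def
proof (rule Sup_subset_mono, clarify)
  fix n and P :: "nat \<Rightarrow> 'a set"
  assume P: "\<forall>i\<le>n. primeideal (P i) R" "\<forall>i<n. P i \<subset> P (Suc i)"
  have "primeideal (h ` P i) S" if "i \<le> n" for i
    using P(1) that primeideal_image by simp
  moreover have "h ` P i \<subset> h ` P (Suc i)" if "i < n" for i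
    using P(2) that primeideal_subset_carrier[of "P (Suc i)" R] P(1) by (intro image_psubset) simp_all
  ultimately show "\<exists>n'. enat n = enat n' \<and> (\<exists>Q. (\<forall>i\<le>n'. primeideal (Q i) S) \<and> (\<forall>i<n'. Q i \<subset> Q (Suc i)))"
    by (intro exI[of _ n] exI[of _ "\<lambda>i. h ` P i"] conjI allI impI refl)
qed

lemma regular_sequence_image:
  assumes "regular_sequence R xs"
  shows "regular_sequence S (map h xs)"
proof -
  have xs: "set xs \<subseteq> carrier R"
    and reg: "\<And>i a. i < length xs \<Longrightarrow> a \<in> carrier R \<Longrightarrow> xs ! i \<otimes> a \<in> Idl\<^bsub>R\<^esub> (set (take i xs)) \<Longrightarrow>
        a \<in> Idl\<^bsub>R\<^esub> (set (take i xs))"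
    and ne: "Idl\<^bsub>R\<^esub> (set xs) \<noteq> carrier R"
    using assms by (auto simp: regular_sequence_def)
  have gen: "Idl\<^bsub>S\<^esub> (h ` set (take i xs)) = h ` (Idl\<^bsub>R\<^esub> (set (take i xs)))"
    and sub: "Idl\<^bsub>R\<^esub> (set (take i xs)) \<subseteq> carrier R" for i
  proof -
    have *: "set (take i xs) \<subseteq> carrier R" using xs set_take_subset[of i xs] by auto
    then show "Idl\<^bsub>S\<^esub> (h ` set (take i xs)) = h ` (Idl\<^bsub>R\<^esub> (set (take i xs)))"
      by (rule genideal_image)
    show "Idl\<^bsub>R\<^esub> (set (take i xs)) \<subseteq> carrier R"
      by (rule ideal_subset_carrier[OF R.genideal_ideal[OF *]])
  qed
  have "b \<in> Idl\<^bsub>S\<^esub> (h ` set (take i xs))"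
    if i: "i < length xs" and b: "b \<in> carrier S" "h (xs ! i) \<otimes>\<^bsub>S\<^esub> b \<in> Idl\<^bsub>S\<^esub> (h ` set (take i xs))" for i b
  proof -
    obtain a where a: "a \<in> carrier R" "b = h a" using b(1) image_carrier by blast
    have xi: "xs ! i \<in> carrier R" using xs i by auto
    have "h (xs ! i \<otimes> a) \<in> h ` (Idl\<^bsub>R\<^esub> (set (take i xs)))"
      using b(2) xi a unfolding gen by simp
    then have "xs ! i \<otimes> a \<in> Idl\<^bsub>R\<^esub> (set (take i xs))"
      using mem_image_iff[OF sub, of "xs ! i \<otimes> a" i] xi a by (simp del: hom.hom_mult)
    then show ?thesis using reg[OF i a(1)] a(2) unfolding gen by blast
  qed
  moreover have "Idl\<^bsub>S\<^esub> (h ` set xs) \<noteq> carrier S"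
    using genideal_image[OF xs] image_eq_iff[OF sub[of "length xs"] subset_refl] ne image_carrier
    by simp
  ultimately show ?thesis
    using xs unfolding regular_sequence_def by (auto simp: take_map)
qed

lemma ideal_depth_le: "ideal_depth R I \<le> ideal_depth S (h ` I)"
  unfolding ideal_depth_def
proof (rule Sup_subset_mono, clarify)
  fix xs assume "regular_sequence R xs" "set xs \<subseteq> I"
  then show "\<exists>ys. enat (length xs) = enat (length ys) \<and> regular_sequence S ys \<and> set ys \<subseteq> h ` I"
    using regular_sequence_image by (intro exI[of _ "map h xs"]) auto
qed

lemma krull_dim_eq: "krull_dim R = krull_dim S"
  using krull_dim_le cring_iso.krull_dim_le[OF inverse_iso] by (rule antisym)

lemma h_inv_image: "I \<subseteq> carrier R \<Longrightarrow> h_inv ` (h ` I) = I"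
  by (force simp: h_inv_h subset_iff image_iff)

lemma ideal_depth_eq:
  assumes "I \<subseteq> carrier R"
  shows "ideal_depth R I = ideal_depth S (h ` I)"
  using ideal_depth_le[of I] cring_iso.ideal_depth_le[OF inverse_iso, of "h ` I"]
  by (simp add: h_inv_image[OF assms])

lemma maximalideals_image: "{N. maximalideal N S} = (`) h ` {N. maximalideal N R}"
proof safe
  fix N assume N: "maximalideal N S"
  then have "maximalideal (h_inv ` N) R"
    by (rule cring_iso.maximalideal_image[OF inverse_iso])
  moreover have "N \<subseteq> carrier S" by (rule maximalideal_subset_carrier) fact
  then have "N = h ` (h_inv ` N)" by (force simp: h_h_inv subset_iff image_iff)
  ultimately show "N \<in> (`) h ` {N. maximalideal N R}" by blast
qed (rule maximalideal_image)

lemma cohen_macaulay_local_ring_image: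
  assumes "cohen_macaulay_local_ring R"
  shows "cohen_macaulay_local_ring S"
proof -
  obtain M where M: "noetherian_ring R" "{N. maximalideal N R} = {M}" "ideal_depth R M = krull_dim R"
    using assms by (auto simp: cohen_macaulay_local_ring_def)
  then have "maximalideal M R" by blast
  then have "ideal_depth S (h ` M) = krull_dim S"
    using ideal_depth_eq[OF maximalideal_subset_carrier] krull_dim_eq M(3) by simp
  moreover have "{N. maximalideal N S} = {h ` M}"
    by (simp add: maximalideals_image M(2))
  ultimately show ?thesis
    using noetherian_image[OF M(1)] S.is_cring by (auto simp: cohen_macaulay_local_ring_def)
qed

text \<open>Elements of a localization are sets of pairs, and applying \<open>h\<close> to both components of all
  pairs maps the class of \<open>(a, s)\<close> onto the class of \<open>(h a, h s)\<close>.\<close>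

lemma localization_iso:
  assumes "multiplicative_set R T"
  shows "cring_iso (localization R T) (localization S (h ` T)) (\<lambda>X. map_prod h h ` X)"
proof -
  interpret T: multiplicative_set R T by fact
  interpret U: multiplicative_set S "h ` T"
  proof
    show "h ` T \<subseteq> carrier S" using T.S_carr by auto
    show "\<one>\<^bsub>S\<^esub> \<in> h ` T" using T.one_S by (metis hom.hom_one imageI)
    fix s t assume "s \<in> h ` T" "t \<in> h ` T"
    then show "s \<otimes>\<^bsub>S\<^esub> t \<in> h ` T"
      using T.mult_S by (auto simp flip: hom.hom_mult)
  qed
  let ?f = "\<lambda>X. map_prod h h ` X"
  have rel: "((h a, h s), (h b, h t)) \<in> fraction_rel S (h ` T) \<longleftrightarrow> ((a, s), (b, t)) \<in> fraction_rel R T"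
    if "a \<in> carrier R" "s \<in> T" "b \<in> carrier R" "t \<in> T" for a s b t
  proof -
    have "(h u \<otimes>\<^bsub>S\<^esub> (h t \<otimes>\<^bsub>S\<^esub> h a) = h u \<otimes>\<^bsub>S\<^esub> (h s \<otimes>\<^bsub>S\<^esub> h b)) \<longleftrightarrow>
        (u \<otimes> (t \<otimes> a) = u \<otimes> (s \<otimes> b))" if "u \<in> T" for u
      using that \<open>a \<in> _\<close> \<open>s \<in> _\<close> \<open>b \<in> _\<close> \<open>t \<in> _\<close> by (simp add: h_eq_iff flip: hom.hom_mult)
    then show ?thesis
      using that unfolding T.fraction_rel_iff U.fraction_rel_iff by auto
  qed
  have f: "?f (T.frac a s) = U.frac (h a) (h s)" if as: "a \<in> carrier R" "s \<in> T" for a s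
  proof (intro equalityI subsetI)
    fix p assume "p \<in> ?f (T.frac a s)"
    then obtain b t where "p = (h b, h t)" "(b, t) \<in> T.frac a s" by auto
    then show "p \<in> U.frac (h a) (h s)"
      using rel[of a s b t] as T.mem_fracD[OF as] by (auto simp: T.mem_frac_iff U.mem_frac_iff)
  next
    fix p assume p: "p \<in> U.frac (h a) (h s)"
    obtain b' t' where p': "p = (b', t')" by fastforce
    have has: "h a \<in> carrier S" "h s \<in> h ` T" using as by auto
    have "b' \<in> h ` carrier R" "t' \<in> h ` T"
      using U.mem_fracD[OF has p[unfolded p']] by (simp_all add: image_carrier)
    then obtain b t where bt: "p = (h b, h t)" "b \<in> carrier R" "t \<in> T"
      unfolding p' by auto
    have "(b, t) \<in> T.frac a s"
      using p rel[of a s b t] as bt by (simp add: T.mem_frac_iff U.mem_frac_iff)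
    then show "p \<in> ?f (T.frac a s)" using bt(1) by force
  qed
  show ?thesis
  proof (intro cring_iso.intro cring_iso_axioms.intro T.cring_localization U.cring_localization ring_iso_memI)
    fix X assume "X \<in> carrier T.L"
    then show "?f X \<in> carrier U.L" by (elim T.localizationE) (simp add: f)
  next
    fix X Y assume "X \<in> carrier T.L" "Y \<in> carrier T.L"
    then show "?f (X \<otimes>\<^bsub>T.L\<^esub> Y) = ?f X \<otimes>\<^bsub>U.L\<^esub> ?f Y" "?f (X \<oplus>\<^bsub>T.L\<^esub> Y) = ?f X \<oplus>\<^bsub>U.L\<^esub> ?f Y"
      by (elim T.localizationE; simp add: f T.mult_frac U.mult_frac T.add_frac U.add_frac T.mult_S)+
  next
    show "?f \<one>\<^bsub>T.L\<^esub> = \<one>\<^bsub>U.L\<^esub>"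
      by (simp add: T.one_localization U.one_localization f T.one_S)
  next
    have sub: "X \<subseteq> carrier R \<times> carrier R" if X: "X \<in> carrier T.L" for X
    proof -
      obtain a s where as: "a \<in> carrier R" "s \<in> T" "X = T.frac a s" using X by (rule T.localizationE)
      show ?thesis unfolding as(3) using T.mem_fracD[OF as(1,2)] T.S_closed by auto
    qed
    have inj: "inj_on ?f (carrier T.L)"
    proof
      fix X Y assume XY: "X \<in> carrier T.L" "Y \<in> carrier T.L" "?f X = ?f Y"
      have "inj_on (map_prod h h) (carrier R \<times> carrier R)"
        using bij by (intro map_prod_inj_on) (simp_all add: bij_betw_def)
      then show "X = Y"
        using XY(3) by (rule inj_on_image_eq_iff[THEN iffD1, OF _ sub[OF XY(1)] sub[OF XY(2)]])
    qed
    have "carrier U.L \<subseteq> ?f ` carrier T.L"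
    proof
      fix Y assume "Y \<in> carrier U.L"
      then obtain b t where bt: "b \<in> carrier S" "t \<in> h ` T" "Y = U.frac b t"
        by (rule U.localizationE)
      obtain a where a: "a \<in> carrier R" "b = h a" using bt(1) unfolding image_carrier[symmetric] by auto
      obtain s where s: "s \<in> T" "t = h s" using bt(2) by auto
      show "Y \<in> ?f ` carrier T.L"
        unfolding bt(3) a(2) s(2) f[OF a(1) s(1), symmetric]
        by (intro imageI T.frac_closed a s)
    qed
    moreover have "?f ` carrier T.L \<subseteq> carrier U.L"
      by (rule image_subsetI) (elim T.localizationE, simp add: f)
    ultimately show "bij_betw ?f (carrier T.L) (carrier U.L)"
      using inj by (simp add: bij_betw_def)
  qed
qed

theorem cohen_macaulay_ring_image:
  assumes "cohen_macaulay_ring R"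
  shows "cohen_macaulay_ring S"
  unfolding cohen_macaulay_ring_def
proof (intro conjI allI impI)
  show "cring S" by (rule S.is_cring)
  show "noetherian_ring S" using assms noetherian_image by (simp add: cohen_macaulay_ring_def)
  fix N assume "maximalideal N S"
  then obtain M where M: "maximalideal M R" "N = h ` M" using maximalideals_image by blast
  have MR: "M \<subseteq> carrier R" by (rule maximalideal_subset_carrier) fact
  have im: "h ` (carrier R - M) = carrier S - N"
    using M(2) MR image_carrier bij inj_on_image_set_diff[of h "carrier R" "carrier R" M]
    by (simp add: bij_betw_def)
  interpret loc: cring_iso "localization R (carrier R - M)" "localization S (carrier S - N)" "\<lambda>X. map_prod h h ` X"
    using localization_iso[OF R.multiplicative_set_prime[OF R.maximalideal_prime[OF M(1)]]] unfolding im .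
  show "cohen_macaulay_local_ring (localization S (carrier S - N))"
    using assms M(1) by (intro loc.cohen_macaulay_local_ring_image) (simp add: cohen_macaulay_ring_def)
qed

end

lemma cohen_macaulay_ring_iso:
  assumes "cring R" "cring S" "R \<simeq> S" "cohen_macaulay_ring R"
  shows "cohen_macaulay_ring S"
proof -
  obtain h where "h \<in> ring_iso R S" using assms(3) by (auto simp: is_ring_iso_def)
  then interpret cring_iso R S h
    using assms by (intro cring_iso.intro cring_iso_axioms.intro)
  show ?thesis by (rule cohen_macaulay_ring_image) fact
qed

section \<open>A criterion for Cohen--Macaulay rings of dimension one\<close>

definition (in cring) nonzerodivisor :: "'a \<Rightarrow> bool" where
  "nonzerodivisor f \<longleftrightarrow> f \<in> carrier R \<and> (\<forall>a \<in> carrier R. f \<otimes> a = \<zero> \<longrightarrow> a = \<zero>)"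

text \<open>The Krull dimension of a commutative ring is at most one if and only if all pairs of elements
  satisfy this identity (Coquand and Lombardi). The identity speaks of elements only, so it is
  easily transported along homomorphisms.\<close>

definition (in cring) collapses :: "'a \<Rightarrow> 'a \<Rightarrow> bool" where
  "collapses a b \<longleftrightarrow> (\<exists>(n::nat) (m::nat). \<exists>x\<in>carrier R. \<exists>y\<in>carrier R.
     a [^] n \<otimes> (b [^] m \<otimes> (\<one> \<oplus> b \<otimes> y) \<oplus> a \<otimes> x) = \<zero>)"

lemma (in noetherian_ring) ideal_family_has_maximal:
  assumes "\<F> \<noteq> {}" "\<And>I. I \<in> \<F> \<Longrightarrow> ideal I R"
  obtains I where "I \<in> \<F>" "\<And>J. J \<in> \<F> \<Longrightarrow> I \<subseteq> J \<Longrightarrow> J = I"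
proof -
  have "\<exists>M\<in>\<F>. \<forall>X\<in>\<F>. M \<subseteq> X \<longrightarrow> X = M"
  proof (rule subset_Zorn_nonempty[OF assms(1)])
    fix C assume C: "C \<noteq> {}" "subset.chain \<F> C"
    have "subset.chain {I. ideal I R} C"
      using C(2) assms(2) unfolding subset.chain_def by blast
    then have "\<Union>C \<in> C" using ideal_chain_is_trivial C(1) by blast
    then show "\<Union>C \<in> \<F>" using C(2) unfolding subset.chain_def by blast
  qed
  then show thesis using that by blast
qed

context cring
begin

lemma colon_ideal:
  assumes "ideal I R" "a \<in> carrier R"
  shows "ideal {x \<in> carrier R. a \<otimes> x \<in> I} R" "I \<subseteq> {x \<in> carrier R. a \<otimes> x \<in> I}"
proof -
  interpret ideal I R by fact
  show "ideal {x \<in> carrier R. a \<otimes> x \<in> I} R"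
    using is_cring assms(2) by (rule helper_max_prime)
  show "I \<subseteq> {x \<in> carrier R. a \<otimes> x \<in> I}" using assms(2) I_l_closed a_Hcarr by auto
qed

text \<open>Choose \<open>Q\<close> maximal among the ideals that contain no power of \<open>f\<close>. If \<open>c \<otimes> d \<in> Q\<close> and
  \<open>d \<notin> Q\<close>, then the colon ideal of \<open>Q\<close> by \<open>c\<close> is strictly larger than \<open>Q\<close>, hence
  \<open>c \<otimes> f [^] i \<in> Q\<close> for some \<open>i\<close>. For \<open>a \<otimes> b \<in> Q\<close> with both factors outside \<open>Q\<close>, this
  argument trades first \<open>b\<close> and then \<open>a\<close> for a power of \<open>f\<close>, so a power of \<open>f\<close> would lie in \<open>Q\<close>.\<close>

lemma prime_avoiding_powers:
  assumes "noetherian_ring R" "f \<in> carrier R" "\<And>n::nat. f [^] n \<noteq> \<zero>"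
  obtains Q where "primeideal Q R" "f \<notin> Q"
proof -
  interpret noetherian_ring R by fact
  let ?F = "{I. ideal I R \<and> (\<forall>n::nat. f [^] n \<notin> I)}"
  have "{\<zero>} \<in> ?F" using zeroideal assms(3) by simp
  then have "?F \<noteq> {}" by blast
  then obtain Q where Q: "Q \<in> ?F" and max: "\<And>J. J \<in> ?F \<Longrightarrow> Q \<subseteq> J \<Longrightarrow> J = Q"
    by (rule ideal_family_has_maximal[of ?F]) auto
  then have iQ: "ideal Q R" and avoid: "\<And>n::nat. f [^] n \<notin> Q" by auto
  have meets: "\<exists>n::nat. c \<otimes> f [^] n \<in> Q"
    if c: "c \<in> carrier R" and d: "d \<in> carrier R" "d \<notin> Q" "c \<otimes> d \<in> Q" for c d
  proof (rule ccontr)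
    let ?K = "{x \<in> carrier R. c \<otimes> x \<in> Q}"
    assume "\<not> ?thesis"
    then have "?K \<in> ?F" using colon_ideal(1)[OF iQ c] by simp
    then have "?K = Q" using max colon_ideal(2)[OF iQ c] by blast
    then show False using d by blast
  qed
  have "primeideal Q R"
  proof (rule primeidealI[OF iQ is_cring])
    show "carrier R \<noteq> Q" using avoid[of 0] by auto
    fix a b assume ab: "a \<in> carrier R" "b \<in> carrier R" "a \<otimes> b \<in> Q"
    show "a \<in> Q \<or> b \<in> Q"
    proof (rule ccontr)
      assume n: "\<not> (a \<in> Q \<or> b \<in> Q)"
      then obtain i :: nat where "a \<otimes> f [^] i \<in> Q" using meets[of a b] ab by auto
      then have "f [^] i \<otimes> a \<in> Q" using ab assms(2) by (simp add: m_comm)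
      then obtain j :: nat where "f [^] i \<otimes> f [^] j \<in> Q"
        using meets[of "f [^] i" a] ab assms(2) n by auto
      then show False using avoid[of "i + j"] assms(2) by (simp add: nat_pow_mult)
    qed
  qed
  then show thesis using that avoid[of 1] assms(2) by simp
qed

lemma proper_ideal_below_maximal:
  assumes "noetherian_ring R" "ideal I R" "I \<noteq> carrier R"
  obtains M where "maximalideal M R" "I \<subseteq> M"
proof -
  interpret noetherian_ring R by fact
  let ?F = "{J. ideal J R \<and> J \<noteq> carrier R \<and> I \<subseteq> J}"
  have "?F \<noteq> {}" using assms(2,3) by blast
  then obtain M where M: "M \<in> ?F" and max: "\<And>J. J \<in> ?F \<Longrightarrow> M \<subseteq> J \<Longrightarrow> J = M"
    by (rule ideal_family_has_maximal[of ?F]) auto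
  have "maximalideal M R"
  proof (rule maximalidealI)
    show "ideal M R" "carrier R \<noteq> M" using M by auto
    fix J assume J: "ideal J R" "M \<subseteq> J"
    then show "J = M \<or> J = carrier R" using max[of J] M by blast
  qed
  then show thesis using that M by blast
qed

lemma genideal_empty: "Idl {} = {\<zero>}"
  using genideal_minimal[OF zeroideal, of "{}"] additive_subgroup.zero_closed[OF ideal.axioms(1)[OF genideal_ideal[of "{}"]]]
  by auto

text \<open>Take \<open>a\<close> in \<open>Q\<close> but not in \<open>P\<close>, and \<open>b\<close> in \<open>N\<close> but not in \<open>Q\<close>. In the identity for
  \<open>a\<close> and \<open>b\<close>, the power of \<open>a\<close> cancels modulo \<open>P\<close>. Modulo \<open>Q\<close> the multiple of \<open>a\<close> disappears
  and the power of \<open>b\<close> cancels, which leaves \<open>1 + b y\<close> in \<open>Q \<subseteq> N\<close>. Since \<open>b\<close> is in \<open>N\<close>, so is 1.\<close>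

lemma prime_chain_length_le_one:
  assumes coll: "\<forall>a\<in>carrier R. \<forall>b\<in>carrier R. collapses a b"
    and P: "primeideal P R" "primeideal Q R" "primeideal N R" "P \<subset> Q" "Q \<subset> N"
  shows False
proof -
  interpret P: primeideal P R by fact
  interpret Q: primeideal Q R by fact
  interpret N: primeideal N R by fact
  have pow: "b [^] (m::nat) \<otimes> c \<in> K \<Longrightarrow> c \<in> K"
    if "primeideal K R" "b \<in> carrier R" "b \<notin> K" "c \<in> carrier R" for K b m c
  proof (induction m)
    case 0 then show ?case using that by simp
  next
    case (Suc m)
    then have "b \<otimes> (b [^] m \<otimes> c) \<in> K" using that by (simp add: m_ac)
    then show ?case using primeideal.I_prime[OF that(1), of b "b [^] m \<otimes> c"] that Suc by auto
  qed
  obtain a where a: "a \<in> Q" "a \<notin> P" using P(4) by auto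
  obtain b where b: "b \<in> N" "b \<notin> Q" using P(5) by auto
  have ab: "a \<in> carrier R" "b \<in> carrier R" using a b Q.Icarr N.Icarr by auto
  obtain n m :: nat and x y where xy: "x \<in> carrier R" "y \<in> carrier R"
    "a [^] n \<otimes> (b [^] m \<otimes> (\<one> \<oplus> b \<otimes> y) \<oplus> a \<otimes> x) = \<zero>"
    using coll ab unfolding collapses_def by blast
  let ?w = "b [^] m \<otimes> (\<one> \<oplus> b \<otimes> y)"
  have w: "?w \<in> carrier R" using ab xy by simp
  have "?w \<oplus> a \<otimes> x \<in> P"
    by (rule pow[OF P(1) ab(1) a(2), of _ n]) (use xy ab in simp_all)
  then have "?w \<oplus> a \<otimes> x \<in> Q" using P(4) by blast
  moreover have "a \<otimes> x \<in> Q" using a xy Q.I_r_closed by simp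
  ultimately have "(?w \<oplus> a \<otimes> x) \<ominus> a \<otimes> x \<in> Q" using Q.a_inv_closed by (simp add: minus_eq)
  also have "(?w \<oplus> a \<otimes> x) \<ominus> a \<otimes> x = ?w"
    using w ab xy by (simp add: minus_eq a_assoc r_neg)
  finally have "\<one> \<oplus> b \<otimes> y \<in> Q"
    by (rule pow[OF P(2) ab(2) b(2), rotated]) (use ab xy in simp)
  then have "\<one> \<oplus> b \<otimes> y \<in> N" using P(5) by blast
  moreover have "b \<otimes> y \<in> N" using b xy N.I_r_closed by simp
  ultimately have "(\<one> \<oplus> b \<otimes> y) \<ominus> b \<otimes> y \<in> N" by (simp add: minus_eq)
  also have "(\<one> \<oplus> b \<otimes> y) \<ominus> b \<otimes> y = \<one>"
    using ab xy by (simp add: minus_eq a_assoc r_neg)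
  finally show False using N.one_imp_carrier N.I_notcarr by simp
qed

text \<open>The cancellations in the proof for chains of primes are also possible if \<open>a\<close>, \<open>b\<close> begin a
  regular sequence: \<open>a\<close> is a nonzerodivisor, and \<open>b\<close> is one modulo \<open>a\<close>. The conclusion is that
  \<open>1 + b y\<close>, and hence 1, lies in the ideal generated by the sequence.\<close>

lemma regular_sequence_length_le_one:
  assumes coll: "\<forall>a\<in>carrier R. \<forall>b\<in>carrier R. collapses a b"
    and reg: "regular_sequence R xs"
  shows "length xs \<le> 1"
proof (rule ccontr)
  assume "\<not> length xs \<le> 1"
  then obtain a b zs where xs: "xs = a # b # zs"
    by (cases xs; cases "tl xs") auto
  have carr: "set xs \<subseteq> carrier R"
    and r: "\<And>i c. i < length xs \<Longrightarrow> c \<in> carrier R \<Longrightarrow> xs ! i \<otimes> c \<in> Idl (set (take i xs)) \<Longrightarrow>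
        c \<in> Idl (set (take i xs))"
    and ne: "Idl (set xs) \<noteq> carrier R"
    using reg by (auto simp: regular_sequence_def)
  have ab: "a \<in> carrier R" "b \<in> carrier R" using carr xs by auto
  have ra: "c = \<zero>" if "c \<in> carrier R" "a \<otimes> c = \<zero>" for c
    using r[of 0 c] that by (simp add: xs genideal_empty)
  have rb: "c \<in> Idl {a}" if "c \<in> carrier R" "b \<otimes> c \<in> Idl {a}" for c
    using r[of 1 c] that by (simp add: xs)
  have ra_pow: "a [^] (n::nat) \<otimes> c = \<zero> \<Longrightarrow> c = \<zero>" if "c \<in> carrier R" for n c
  proof (induction n)
    case 0 then show ?case using that by simp
  next
    case (Suc n)
    then have "a \<otimes> (a [^] n \<otimes> c) = \<zero>" using that ab by (simp add: m_ac)
    then show ?case using ra[of "a [^] n \<otimes> c"] that ab Suc by simp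
  qed
  have rb_pow: "b [^] (n::nat) \<otimes> c \<in> Idl {a} \<Longrightarrow> c \<in> Idl {a}" if "c \<in> carrier R" for n c
  proof (induction n)
    case 0 then show ?case using that by simp
  next
    case (Suc n)
    then have "b \<otimes> (b [^] n \<otimes> c) \<in> Idl {a}" using that ab by (simp add: m_ac)
    then show ?case using rb[of "b [^] n \<otimes> c"] that ab Suc by simp
  qed
  interpret I: ideal "Idl {a}" R using ab by (intro genideal_ideal) simp
  interpret J: ideal "Idl (set xs)" R by (rule genideal_ideal[OF carr])
  obtain n m :: nat and x y where xy: "x \<in> carrier R" "y \<in> carrier R"
    "a [^] n \<otimes> (b [^] m \<otimes> (\<one> \<oplus> b \<otimes> y) \<oplus> a \<otimes> x) = \<zero>"
    using coll ab unfolding collapses_def by blast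
  let ?w = "b [^] m \<otimes> (\<one> \<oplus> b \<otimes> y)"
  have w: "?w \<in> carrier R" using ab xy by simp
  have "?w \<oplus> a \<otimes> x = \<zero>" by (rule ra_pow[OF _ xy(3)]) (use w ab xy in simp)
  then have "?w = \<ominus> (a \<otimes> x)" using w ab xy by (intro sum_zero_eq_neg) simp_all
  moreover have "a \<otimes> x \<in> Idl {a}"
    using I.I_r_closed[OF genideal_self'[OF ab(1)] xy(1)] .
  ultimately have "?w \<in> Idl {a}" using I.a_inv_closed by simp
  then have "\<one> \<oplus> b \<otimes> y \<in> Idl {a}"
    by (rule rb_pow[rotated]) (use ab xy in simp)
  moreover have "Idl {a} \<subseteq> Idl (set xs)"
    by (rule subset_Idl_subset[OF carr]) (simp add: xs)
  ultimately have "\<one> \<oplus> b \<otimes> y \<in> Idl (set xs)" by blast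
  moreover have "b \<in> Idl (set xs)" using genideal_self[OF carr] by (auto simp: xs)
  then have "b \<otimes> y \<in> Idl (set xs)" using xy J.I_r_closed by simp
  ultimately have "(\<one> \<oplus> b \<otimes> y) \<ominus> b \<otimes> y \<in> Idl (set xs)" by (simp add: minus_eq)
  also have "(\<one> \<oplus> b \<otimes> y) \<ominus> b \<otimes> y = \<one>"
    using ab xy by (simp add: minus_eq a_assoc r_neg)
  finally show False using J.one_imp_carrier ne by simp
qed

lemma krull_dim_le_one:
  assumes "\<forall>a\<in>carrier R. \<forall>b\<in>carrier R. collapses a b"
  shows "krull_dim R \<le> 1"
  unfolding krull_dim_def
proof (rule Sup_least, clarify)
  fix n and P :: "nat \<Rightarrow> 'a set"
  assume P: "\<forall>i\<le>n. primeideal (P i) R" "\<forall>i<n. P i \<subset> P (Suc i)"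
  have "n \<le> 1"
  proof (rule ccontr)
    assume "\<not> n \<le> 1"
    then have "primeideal (P 0) R" "primeideal (P 1) R" "primeideal (P 2) R" "P 0 \<subset> P 1" "P 1 \<subset> P 2"
      using P(1)[rule_format, of 0] P(1)[rule_format, of 1] P(1)[rule_format, of 2]
        P(2)[rule_format, of 0] P(2)[rule_format, of 1] by (simp_all add: numeral_2_eq_2)
    then show False by (rule prime_chain_length_le_one[OF assms])
  qed
  then show "enat n \<le> 1" by (simp add: one_enat_def)
qed

lemma nonzerodivisorD: "nonzerodivisor f \<Longrightarrow> a \<in> carrier R \<Longrightarrow> f \<otimes> a = \<zero> \<Longrightarrow> a = \<zero>"
  unfolding nonzerodivisor_def by blast

lemma nonzerodivisor_pow:
  assumes "nonzerodivisor f" "\<one> \<noteq> \<zero>"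
  shows "f [^] (n::nat) \<noteq> \<zero>"
proof (induction n)
  case 0 then show ?case using assms by simp
next
  case (Suc n)
  then show ?case using assms by (auto simp: nonzerodivisor_def m_comm)
qed

text \<open>The nonzerodivisor \<open>f\<close> is a regular sequence in \<open>M\<close>. No power of it is zero, so some prime
  avoids \<open>f\<close> and lies strictly below \<open>M\<close>. Hence depth and dimension are at least one, and the
  identity bounds both by one.\<close>

theorem cohen_macaulay_local_ring_criterion:
  assumes "noetherian_ring R" and M: "{N. maximalideal N R} = {M}"
    and f: "f \<in> M" "nonzerodivisor f"
    and coll: "\<forall>a\<in>carrier R. \<forall>b\<in>carrier R. collapses a b"
  shows "cohen_macaulay_local_ring R"
proof -
  have max: "maximalideal M R" using M by blast
  interpret M: maximalideal M R by (rule max)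
  have fR: "f \<in> carrier R" using f(2) by (simp add: nonzerodivisor_def)
  have one: "\<one> \<noteq> \<zero>"
    using M.one_imp_carrier M.I_notcarr M.zero_closed by metis
  obtain Q where Q: "primeideal Q R" "f \<notin> Q"
    using prime_avoiding_powers[OF assms(1) fR nonzerodivisor_pow[OF f(2) one]] by blast
  interpret Q: primeideal Q R by (rule Q(1))
  obtain N where "maximalideal N R" "Q \<subseteq> N"
    using proper_ideal_below_maximal[OF assms(1) Q.is_ideal] Q.I_notcarr by metis
  then have "Q \<subset> M" using M f(1) Q(2) by blast
  define P where "P = (\<lambda>i::nat. if i = 0 then Q else M)"
  have "\<forall>i\<le>1. primeideal (P i) R" "\<forall>i<1. P i \<subset> P (Suc i)"
    using Q(1) maximalideal_prime[OF max] \<open>Q \<subset> M\<close> by (simp_all add: P_def)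
  then have "enat 1 \<le> krull_dim R"
    unfolding krull_dim_def by (intro Sup_upper CollectI exI[of _ 1] exI[of _ P] conjI refl)
  with krull_dim_le_one[OF coll] have dim: "krull_dim R = 1"
    by (simp add: one_enat_def)
  have "Idl {f} \<subseteq> M" using genideal_minimal[OF M.is_ideal] f(1) by simp
  then have "Idl {f} \<noteq> carrier R" using M.I_notcarr M.a_subset by blast
  then have "regular_sequence R [f]"
    using f(2) by (auto simp: regular_sequence_def nonzerodivisor_def genideal_empty)
  then have "enat 1 \<le> ideal_depth R M"
    unfolding ideal_depth_def using f(1)
    by (intro Sup_upper CollectI exI[of _ "[f]"]) auto
  moreover have "ideal_depth R M \<le> 1"
    unfolding ideal_depth_def
    using regular_sequence_length_le_one[OF coll] by (intro Sup_least) (auto simp: one_enat_def)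
  ultimately have "ideal_depth R M = krull_dim R" using dim by (simp add: one_enat_def)
  then show ?thesis using assms(1) M is_cring by (auto simp: cohen_macaulay_local_ring_def)
qed

text \<open>A fraction \<open>a / s\<close> is a unit multiple of \<open>a / 1\<close>. The units can be absorbed into \<open>x\<close> and \<open>y\<close>
  after cancelling their powers.\<close>

lemma collapses_unit_multiple:
  assumes c: "a \<in> carrier R" "b \<in> carrier R" "s \<in> carrier R" "t \<in> carrier R"
    "s' \<in> carrier R" "t' \<in> carrier R"
    and inv: "s' \<otimes> s = \<one>" "t' \<otimes> t = \<one>"
    and coll: "collapses (s \<otimes> a) (t \<otimes> b)"
  shows "collapses a b"
proof -
  obtain n m :: nat and x y where xy: "x \<in> carrier R" "y \<in> carrier R" and
    eq: "(s \<otimes> a) [^] n \<otimes> ((t \<otimes> b) [^] m \<otimes> (\<one> \<oplus> t \<otimes> b \<otimes> y) \<oplus> s \<otimes> a \<otimes> x) = \<zero>"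
    using coll unfolding collapses_def by blast
  have cancel: "c = \<zero>" if "u \<otimes> c = \<zero>" "u' \<otimes> u = \<one>" "u \<in> carrier R" "u' \<in> carrier R" "c \<in> carrier R"
    for u u' c
  proof -
    have "c = u' \<otimes> (u \<otimes> c)" using that(2-5) by (simp flip: m_assoc)
    then show ?thesis using that by simp
  qed
  define A B T T' w z where "A = a [^] n" and "B = b [^] m" and "T = t [^] m" and "T' = t' [^] m"
    and "w = \<one> \<oplus> b \<otimes> (t \<otimes> y)" and "z = B \<otimes> w \<oplus> a \<otimes> (T' \<otimes> s \<otimes> x)"
  have C: "A \<in> carrier R" "B \<in> carrier R" "T \<in> carrier R" "T' \<in> carrier R" "w \<in> carrier R" "z \<in> carrier R"
    "s [^] n \<in> carrier R" "s' [^] n \<in> carrier R"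
    using c xy by (simp_all add: A_def B_def T_def T'_def w_def z_def)
  have inv_pow: "s' [^] n \<otimes> s [^] n = \<one>" "T' \<otimes> T = \<one>"
    using inv c by (simp_all add: T_def T'_def flip: nat_pow_distrib)
  have tb: "(t \<otimes> b) [^] m = T \<otimes> B" "(s \<otimes> a) [^] n = s [^] n \<otimes> A"
    using c by (simp_all add: nat_pow_distrib T_def B_def A_def)
  have w: "\<one> \<oplus> t \<otimes> b \<otimes> y = w" using c xy by (simp add: w_def m_ac)
  have "T \<otimes> z = T \<otimes> B \<otimes> w \<oplus> (T' \<otimes> T) \<otimes> (s \<otimes> a \<otimes> x)"
    unfolding z_def using c xy C by (simp add: r_distr m_ac)
  then have "T \<otimes> z = (t \<otimes> b) [^] m \<otimes> (\<one> \<oplus> t \<otimes> b \<otimes> y) \<oplus> s \<otimes> a \<otimes> x"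
    unfolding inv_pow tb w using c xy by simp
  then have "s [^] n \<otimes> A \<otimes> (T \<otimes> z) = \<zero>" using eq unfolding tb by simp
  then have "s [^] n \<otimes> (T \<otimes> (A \<otimes> z)) = \<zero>" using C by (simp add: m_ac)
  then have "T \<otimes> (A \<otimes> z) = \<zero>" by (rule cancel[OF _ inv_pow(1)]) (use C in simp_all)
  then have "A \<otimes> z = \<zero>" by (rule cancel[OF _ inv_pow(2)]) (use C in simp_all)
  moreover have "T' \<otimes> s \<otimes> x \<in> carrier R" "t \<otimes> y \<in> carrier R" using C c xy by simp_all
  ultimately show ?thesis
    unfolding collapses_def A_def z_def B_def w_def by blast
qed

lemma collapses_hom:
  assumes "cring S" "h \<in> ring_hom R S" "a \<in> carrier R" "b \<in> carrier R" "collapses a b"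
  shows "cring.collapses S (h a) (h b)"
proof -
  interpret S: cring S by fact
  interpret h: ring_hom_ring R S h
    by (rule ring_hom_ringI2) (simp_all add: ring_axioms S.ring_axioms assms(2))
  obtain n m :: nat and x y where xy: "x \<in> carrier R" "y \<in> carrier R" and
    eq: "a [^] n \<otimes> (b [^] m \<otimes> (\<one> \<oplus> b \<otimes> y) \<oplus> a \<otimes> x) = \<zero>"
    using assms(5) unfolding collapses_def by blast
  have pow: "h (c [^] k) = h c [^]\<^bsub>S\<^esub> k" if "c \<in> carrier R" for c and k :: nat
    by (induction k) (use that in simp_all)
  have "h (a [^] n \<otimes> (b [^] m \<otimes> (\<one> \<oplus> b \<otimes> y) \<oplus> a \<otimes> x)) = \<zero>\<^bsub>S\<^esub>"
    unfolding eq by simp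
  then have "h a [^]\<^bsub>S\<^esub> n \<otimes>\<^bsub>S\<^esub> (h b [^]\<^bsub>S\<^esub> m \<otimes>\<^bsub>S\<^esub> (\<one>\<^bsub>S\<^esub> \<oplus>\<^bsub>S\<^esub> h b \<otimes>\<^bsub>S\<^esub> h y)
      \<oplus>\<^bsub>S\<^esub> h a \<otimes>\<^bsub>S\<^esub> h x) = \<zero>\<^bsub>S\<^esub>"
    using assms(3,4) xy by (simp add: pow)
  then show ?thesis
    unfolding S.collapses_def using xy h.hom_closed by blast
qed

text \<open>Every hypothesis of the local criterion is inherited by the localization at a maximal ideal
  \<open>M\<close>: a nonzerodivisor stays one, and pairs of fractions are unit multiples of images of pairs
  from \<open>R\<close>.\<close>

theorem cohen_macaulay_ring_criterion:
  assumes "noetherian_ring R"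
    and f: "\<And>M. maximalideal M R \<Longrightarrow> \<exists>f\<in>M. nonzerodivisor f"
    and coll: "\<forall>a\<in>carrier R. \<forall>b\<in>carrier R. collapses a b"
  shows "cohen_macaulay_ring R"
  unfolding cohen_macaulay_ring_def
proof (intro conjI allI impI)
  show "cring R" by (rule is_cring)
  show "noetherian_ring R" by fact
  fix M assume M: "maximalideal M R"
  have prime: "primeideal M R" by (rule maximalideal_prime) fact
  interpret multiplicative_set R "carrier R - M" by (rule multiplicative_set_prime) fact
  obtain f where fM: "f \<in> M" "nonzerodivisor f" using f[OF M] by blast
  then have fR: "f \<in> carrier R" by (simp add: nonzerodivisor_def)
  show "cohen_macaulay_local_ring L"
  proof (rule L.cohen_macaulay_local_ring_criterion)
    show "noetherian_ring L" by (rule noetherian_localization) fact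
    show "{N. maximalideal N L} = {{frac a s | a s. a \<in> M \<and> s \<in> carrier R - M}}"
      by (rule maximalideals_localization) fact
    show "frac f \<one> \<in> {frac a s | a s. a \<in> M \<and> s \<in> carrier R - M}"
      using fM one_S by blast
    show "L.nonzerodivisor (frac f \<one>)"
      unfolding L.nonzerodivisor_def
    proof (intro conjI ballI impI)
      show "frac f \<one> \<in> carrier L" using fR one_S by simp
      fix X assume X: "X \<in> carrier L" "frac f \<one> \<otimes>\<^bsub>L\<^esub> X = \<zero>\<^bsub>L\<^esub>"
      obtain a s where as: "a \<in> carrier R" "s \<in> carrier R - M" "X = frac a s"
        using X(1) by (rule localizationE)
      then have "frac (f \<otimes> a) s = \<zero>\<^bsub>L\<^esub>"
        using X(2) fR one_S by (simp add: mult_frac)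
      then obtain u where u: "u \<in> carrier R - M" "u \<otimes> (f \<otimes> a) = \<zero>"
        using frac_eq_zero_iff[OF _ as(2), of "f \<otimes> a"] fR as(1) by auto
      then have "f \<otimes> (u \<otimes> a) = \<zero>" using fR as(1) by (simp add: m_ac)
      then have "u \<otimes> a = \<zero>" by (rule nonzerodivisorD[OF fM(2), rotated]) (use u(1) as(1) in simp)
      then show "X = \<zero>\<^bsub>L\<^esub>" unfolding as(3) frac_eq_zero_iff[OF as(1,2)] using u(1) by blast
    qed
  next
    show "\<forall>X\<in>carrier L. \<forall>Y\<in>carrier L. L.collapses X Y"
    proof (intro ballI)
      fix X Y assume XY: "X \<in> carrier L" "Y \<in> carrier L"
      obtain a s where as: "a \<in> carrier R" "s \<in> carrier R - M" "X = frac a s"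
        using XY(1) by (rule localizationE)
      obtain b t where bt: "b \<in> carrier R" "t \<in> carrier R - M" "Y = frac b t"
        using XY(2) by (rule localizationE)
      have clear: "frac c \<one> = frac r \<one> \<otimes>\<^bsub>L\<^esub> frac c r" if "c \<in> carrier R" "r \<in> carrier R - M" for c r
        using that one_S by (simp add: mult_frac) (rule frac_eqI; simp add: m_ac)
      have "L.collapses (frac a \<one>) (frac b \<one>)"
        using coll as(1) bt(1) by (intro collapses_hom[OF cring_localization frac_one_hom]) simp_all
      then have *: "L.collapses (frac s \<one> \<otimes>\<^bsub>L\<^esub> X) (frac t \<one> \<otimes>\<^bsub>L\<^esub> Y)"
        unfolding as(3) bt(3) clear[OF as(1,2), symmetric] clear[OF bt(1,2), symmetric] .
      have closed: "frac s \<one> \<in> carrier L" "frac t \<one> \<in> carrier L"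
        "frac \<one> s \<in> carrier L" "frac \<one> t \<in> carrier L"
        using as(2) bt(2) by (intro frac_closed one_S one_closed; simp)+
      show "L.collapses X Y"
        by (rule L.collapses_unit_multiple[OF XY closed frac_inverse[OF one_S as(2)]
              frac_inverse[OF one_S bt(2)] *])
    qed
  qed
qed

end

section \<open>The coordinate ring of a union of coordinate axes\<close>

text \<open>These are \<open>d + 1\<close> vectors in a space of dimension \<open>d\<close>. Linear dependence is a property
  of sets of vectors, so a repetition in the family is treated separately.\<close>

lemma polynomial_vectors_dependent:
  fixes f :: "nat \<Rightarrow> 'k::field poly"
  assumes f: "\<And>j n. n \<ge> d \<Longrightarrow> coeff (f j) n = 0"
  shows "\<exists>c. (\<exists>j\<le>d. c j \<noteq> 0) \<and> (\<Sum>j\<le>d. smult (c j) (f j)) = 0"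
proof (cases "inj_on f {..d}")
  case False
  then obtain i j where ij: "i \<le> d" "j \<le> d" "i \<noteq> j" "f i = f j" by (auto simp: inj_on_def)
  define c where "c = (\<lambda>l. if l = i then 1 else if l = j then -1 else (0::'k))"
  have "(\<Sum>l\<le>d. smult (c l) (f l)) = (\<Sum>l\<in>{i, j}. smult (c l) (f l))"
    using ij by (intro sum.mono_neutral_right) (auto simp: c_def)
  also have "\<dots> = 0" using ij by (simp add: c_def)
  finally show ?thesis using ij(1) by (intro exI[of _ c]) (auto simp: c_def)
next
  case True
  interpret vector_space "smult :: 'k \<Rightarrow> 'k poly \<Rightarrow> 'k poly"
    by standard (simp_all add: smult_add_right smult_add_left)
  let ?T = "(\<lambda>n. monom (1::'k) n) ` {..<d}"
  have "f j \<in> span ?T" for j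
  proof -
    have "f j = (\<Sum>n<d. smult (coeff (f j) n) (monom 1 n))"
    proof (rule poly_eqI)
      fix n
      have "(\<Sum>l<d. coeff (f j) l * (if l = n then 1 else 0)) = (\<Sum>l<d. if l = n then coeff (f j) l else 0)"
        by (intro sum.cong) auto
      then show "coeff (f j) n = coeff (\<Sum>l<d. smult (coeff (f j) l) (monom 1 l)) n"
        using f[of n j] by (simp add: coeff_sum)
    qed
    also have "\<dots> \<in> span ?T" by (intro span_sum span_scale span_base) auto
    finally show ?thesis .
  qed
  then have sub: "f ` {..d} \<subseteq> span ?T" by auto
  have "dependent (f ` {..d})"
  proof (rule ccontr)
    assume "\<not> dependent (f ` {..d})"
    then have "card (f ` {..d}) \<le> card ?T"
      using independent_span_bound[of ?T "f ` {..d}"] sub by simp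
    also have "\<dots> \<le> d" using card_image_le[of "{..<d}"] by simp
    finally show False using card_image[OF True] by simp
  qed
  then obtain u where u: "\<exists>v\<in>f ` {..d}. u v \<noteq> 0" "(\<Sum>v\<in>f ` {..d}. smult (u v) v) = 0"
    by (subst (asm) dependent_finite) auto
  then show ?thesis
    by (intro exI[of _ "u \<circ> f"]) (auto simp: sum.reindex[OF True])
qed

lemma pcompose_monom: "pcompose (monom c n) p = smult c (p ^ n)"
  by (induction n) (simp_all add: monom_Suc pcompose_pCons monom_0)

lemma pcompose_const_right: "pcompose p [:c:] = [:poly p c:]"
  by (induction p) (simp_all add: pcompose_pCons mult.commute)

text \<open>The remainders of \<open>1, b, \<dots>, b\<^sup>d\<close> modulo \<open>a\<close>, where \<open>d\<close> is the degree of \<open>a\<close>, are linearly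
  dependent.\<close>

lemma algebraic_modulo:
  fixes a b :: "'k::field poly"
  assumes "a \<noteq> 0"
  shows "\<exists>q. q \<noteq> 0 \<and> a dvd pcompose q b"
proof -
  let ?d = "Polynomial.degree a"
  have "coeff (b ^ j mod a) n = 0" if "n \<ge> ?d" for j n
    using degree_mod_less[OF assms, of "b ^ j"] that by (auto intro: coeff_eq_0)
  then obtain c where c: "\<exists>j\<le>?d. c j \<noteq> 0" "(\<Sum>j\<le>?d. smult (c j) (b ^ j mod a)) = 0"
    using polynomial_vectors_dependent[of ?d "\<lambda>j. b ^ j mod a"] by blast
  define q where "q = (\<Sum>j\<le>?d. monom (c j) j)"
  have "coeff q j = c j" if "j \<le> ?d" for j
    using that by (simp add: q_def coeff_sum)
  then have "q \<noteq> 0" using c(1) by force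
  have "pcompose q b = (\<Sum>j\<le>?d. smult (c j) (b ^ j))"
    by (simp add: q_def pcompose_sum pcompose_monom)
  also have "\<dots> = (\<Sum>j\<le>?d. a * smult (c j) (b ^ j div a) + smult (c j) (b ^ j mod a))"
    by (intro sum.cong refl) (simp flip: smult_add_right)
  also have "\<dots> = a * (\<Sum>j\<le>?d. smult (c j) (b ^ j div a))"
    by (simp add: sum.distrib c(2) sum_distrib_left)
  finally show ?thesis using \<open>q \<noteq> 0\<close> by auto
qed

text \<open>Substituting \<open>b\<close> into the right-hand side gives \<open>b\<^sup>m (1 + b y)\<close> with \<open>y = r(b)\<close>, the shape
  that occurs in \<open>collapses\<close>.\<close>

lemma nonzero_poly_lowest_term:
  fixes q :: "'k::field poly"
  assumes "q \<noteq> 0"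
  shows "\<exists>c m r. c \<noteq> 0 \<and> smult c q = monom 1 m * pCons 1 r"
  using assms
proof (induction q)
  case 0 then show ?case by simp
next
  case (pCons a q)
  show ?case
  proof (cases "a = 0")
    case False
    then show ?thesis
      by (intro exI[of _ "1 / a"] exI[of _ 0] exI[of _ "smult (1 / a) q"]) (simp add: monom_0)
  next
    case True
    then have "q \<noteq> 0" using pCons by auto
    then obtain c m r where *: "c \<noteq> 0" "smult c q = monom 1 m * pCons 1 r" using pCons by blast
    then show ?thesis using True
      by (intro exI[of _ c] exI[of _ "Suc m"] exI[of _ r]) (simp add: monom_Suc)
  qed
qed

text \<open>Division with remainder by a nonzero element of least degree.\<close>

lemma poly_ideal_principal:
  fixes J :: "'k::field poly set"
  assumes "0 \<in> J" "\<And>f g. f \<in> J \<Longrightarrow> g \<in> J \<Longrightarrow> f + g \<in> J" "\<And>f h. f \<in> J \<Longrightarrow> h * f \<in> J"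
  shows "\<exists>g\<in>J. \<forall>f\<in>J. g dvd f"
proof (cases "J \<subseteq> {0}")
  case True then show ?thesis using assms(1) by blast
next
  case False
  then obtain g0 where "g0 \<in> J \<and> g0 \<noteq> 0" by blast
  from ex_has_least_nat[of "\<lambda>g. g \<in> J \<and> g \<noteq> 0", OF this, of Polynomial.degree]
  obtain g where g: "g \<in> J" "g \<noteq> 0"
    and min: "\<And>f. f \<in> J \<and> f \<noteq> 0 \<Longrightarrow> Polynomial.degree g \<le> Polynomial.degree f"
    by blast
  have "g dvd f" if f: "f \<in> J" for f
  proof -
    have "f mod g = f + (- (f div g)) * g" by (simp add: minus_div_mult_eq_mod[symmetric])
    then have "f mod g \<in> J" using assms(2)[OF f assms(3)[OF g(1)]] by metis
    then have "f mod g = 0" using min[of "f mod g"] degree_mod_less[OF g(2), of f] by fastforce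
    then show ?thesis by (simp add: mod_eq_0_iff_dvd)
  qed
  then show ?thesis using g(1) by blast
qed

text \<open>The coordinate ring of the union of the coordinate axes, an element being given by its
  restrictions to the axes, which agree at the origin. Outside \<open>V\<close> the components are the common
  constant. With this convention the operations are pointwise with unit \<open>\<lambda>i. 1\<close>, and restricting a
  polynomial in the variables \<open>V\<close> gives an element of the ring also at the indices outside \<open>V\<close>.\<close>

definition axes_ring :: "'v set \<Rightarrow> ('v \<Rightarrow> 'k::field poly) ring" where
  "axes_ring V =
    \<lparr> carrier = {f. \<exists>c. (\<forall>i. coeff (f i) 0 = c) \<and> (\<forall>i. i \<notin> V \<longrightarrow> f i = [:c:])},
      mult = (\<lambda>f g i. f i * g i), one = (\<lambda>i. 1),
      zero = (\<lambda>i. 0), add = (\<lambda>f g i. f i + g i) \<rparr>"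

text \<open>This embeds \<open>k[X]\<close> into the ring of the axes; \<open>X\<close> is mapped to the restriction of the sum of
  all variables.\<close>

definition diagonal :: "'v set \<Rightarrow> 'k::field poly \<Rightarrow> 'v \<Rightarrow> 'k poly" where
  "diagonal V h i = (if i \<in> V then h else [:coeff h 0:])"

lemma axes_ring_simps [simp]:
  "mult (axes_ring V) f g = (\<lambda>i. f i * g i)" "one (axes_ring V) = (\<lambda>i. 1)"
  "zero (axes_ring V) = (\<lambda>i. 0)" "add (axes_ring V) f g = (\<lambda>i. f i + g i)"
  by (simp_all add: axes_ring_def)

lemma axes_ring_carrier:
  "f \<in> carrier (axes_ring V) \<longleftrightarrow> (\<exists>c. (\<forall>i. coeff (f i) 0 = c) \<and> (\<forall>i. i \<notin> V \<longrightarrow> f i = [:c:]))"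
  by (simp add: axes_ring_def)

lemma diagonal_in_carrier: "diagonal V h \<in> carrier (axes_ring V)"
  by (simp add: axes_ring_carrier diagonal_def)

lemma axes_ring_uminus_closed:
  "f \<in> carrier (axes_ring V) \<Longrightarrow> (\<lambda>i. - f i) \<in> carrier (axes_ring V)"
  by (auto simp: axes_ring_carrier)

lemma cring_axes_ring: "cring (axes_ring V :: ('v \<Rightarrow> 'k::field poly) ring)"
proof (rule cringI)
  have add: "(\<lambda>i. f i + g i) \<in> carrier (axes_ring V)"
    if fg: "f \<in> carrier (axes_ring V)" "g \<in> carrier (axes_ring V)" for f g :: "'v \<Rightarrow> 'k poly"
  proof -
    obtain c d where "\<forall>i. coeff (f i) 0 = c" "\<forall>i. i \<notin> V \<longrightarrow> f i = [:c:]"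
      "\<forall>i. coeff (g i) 0 = d" "\<forall>i. i \<notin> V \<longrightarrow> g i = [:d:]"
      using fg unfolding axes_ring_carrier by blast
    then show ?thesis unfolding axes_ring_carrier by (intro exI[of _ "c + d"]) simp
  qed
  have mult: "(\<lambda>i. f i * g i) \<in> carrier (axes_ring V)"
    if fg: "f \<in> carrier (axes_ring V)" "g \<in> carrier (axes_ring V)" for f g :: "'v \<Rightarrow> 'k poly"
  proof -
    obtain c d where "\<forall>i. coeff (f i) 0 = c" "\<forall>i. i \<notin> V \<longrightarrow> f i = [:c:]"
      "\<forall>i. coeff (g i) 0 = d" "\<forall>i. i \<notin> V \<longrightarrow> g i = [:d:]"
      using fg unfolding axes_ring_carrier by blast
    then show ?thesis unfolding axes_ring_carrier
      by (intro exI[of _ "c * d"]) (simp add: coeff_mult_0)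
  qed
  show "abelian_group (axes_ring V :: ('v \<Rightarrow> 'k::field poly) ring)"
  proof (rule abelian_groupI)
    fix f :: "'v \<Rightarrow> 'k poly" assume "f \<in> carrier (axes_ring V)"
    then show "\<exists>g\<in>carrier (axes_ring V). g \<oplus>\<^bsub>axes_ring V\<^esub> f = \<zero>\<^bsub>axes_ring V\<^esub>"
      by (intro bexI[OF _ axes_ring_uminus_closed]) simp_all
  qed (simp_all add: add ac_simps, simp add: axes_ring_carrier)
  show "comm_monoid (axes_ring V :: ('v \<Rightarrow> 'k::field poly) ring)"
    by (rule comm_monoidI) (simp_all add: mult ac_simps, simp add: axes_ring_carrier)
qed (simp add: algebra_simps)

lemma axes_ring_eqI:
  assumes "V \<noteq> {}" "f \<in> carrier (axes_ring V)" "g \<in> carrier (axes_ring V)" "\<And>i. i \<in> V \<Longrightarrow> f i = g i"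
  shows "f = g"
proof
  obtain c d where *: "\<forall>i. coeff (f i) 0 = c" "\<forall>i. i \<notin> V \<longrightarrow> f i = [:c:]"
    "\<forall>i. coeff (g i) 0 = d" "\<forall>i. i \<notin> V \<longrightarrow> g i = [:d:]"
    using assms(2,3) unfolding axes_ring_carrier by blast
  obtain j where "j \<in> V" using assms(1) by blast
  then have "c = d" using * assms(4)[of j] by metis
  then show "f i = g i" for i using * assms(4)[of i] by (cases "i \<in> V") simp_all
qed

lemma axes_ring_pcompose_closed:
  assumes "b \<in> carrier (axes_ring V)"
  shows "(\<lambda>i. pcompose q (b i)) \<in> carrier (axes_ring V)"
proof -
  obtain c where *: "\<forall>i. coeff (b i) 0 = c" "\<forall>i. i \<notin> V \<longrightarrow> b i = [:c:]"
    using assms unfolding axes_ring_carrier by blast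
  then show ?thesis
    unfolding axes_ring_carrier
    by (intro exI[of _ "poly q c"]) (simp add: pcompose_const_right poly_pcompose flip: poly_0_coeff_0)
qed

text \<open>Submodules over \<open>k[X]\<close>, which acts through the diagonal.\<close>

definition poly_submodule :: "'v set \<Rightarrow> ('v \<Rightarrow> 'k::field poly) set \<Rightarrow> bool" where
  "poly_submodule V J \<longleftrightarrow> (\<lambda>i. 0) \<in> J \<and> (\<forall>f\<in>J. \<forall>g\<in>J. (\<lambda>i. f i + g i) \<in> J) \<and>
     (\<forall>f\<in>J. \<forall>h. (\<lambda>i. diagonal V h i * f i) \<in> J)"

lemma poly_submodule_add:
  "poly_submodule V J \<Longrightarrow> f \<in> J \<Longrightarrow> g \<in> J \<Longrightarrow> (\<lambda>i. f i + g i) \<in> J"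
  by (simp add: poly_submodule_def)

text \<open>The components at \<open>w\<close> of the elements of \<open>J\<close> form a principal ideal of \<open>k[X]\<close>, generated
  by the component of some \<open>f0\<close>. Subtracting a multiple of \<open>f0\<close> makes the component at \<open>w\<close>
  vanish, which reduces the claim to one coordinate less. That \<open>A\<close> generates \<open>J\<close> is expressed by
  saying that every submodule containing \<open>A\<close> contains \<open>J\<close>.\<close>

lemma poly_submodule_finitely_generated:
  assumes "finite W" "W \<subseteq> V" "poly_submodule V J"
    and "\<And>f. f \<in> J \<Longrightarrow> (\<And>i. i \<in> W \<Longrightarrow> f i = 0) \<Longrightarrow> f = (\<lambda>i. 0)"
  shows "\<exists>A\<subseteq>J. finite A \<and> (\<forall>K. A \<subseteq> K \<longrightarrow> poly_submodule V K \<longrightarrow> J \<subseteq> K)"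
  using assms
proof (induction W arbitrary: J rule: finite_induct)
  case empty
  then show ?case by (intro exI[of _ "{}"]) (auto simp: poly_submodule_def)
next
  case (insert w W)
  have zero: "(\<lambda>i. 0) \<in> J" and add: "\<And>f g. f \<in> J \<Longrightarrow> g \<in> J \<Longrightarrow> (\<lambda>i. f i + g i) \<in> J"
    and scale: "\<And>f h. f \<in> J \<Longrightarrow> (\<lambda>i. diagonal V h i * f i) \<in> J"
    using insert.prems(2) by (auto simp: poly_submodule_def)
  have w: "diagonal V h w = h" for h using insert.prems(1) by (simp add: diagonal_def)
  have "\<exists>g\<in>(\<lambda>f. f w) ` J. \<forall>f\<in>(\<lambda>f. f w) ` J. g dvd f"
  proof (rule poly_ideal_principal)
    show "0 \<in> (\<lambda>f. f w) ` J" using zero by force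
    fix p q assume "p \<in> (\<lambda>f. f w) ` J" "q \<in> (\<lambda>f. f w) ` J"
    then show "p + q \<in> (\<lambda>f. f w) ` J" using add by force
  next
    fix p h assume "p \<in> (\<lambda>f. f w) ` J"
    then obtain f where "f \<in> J" "p = f w" by blast
    then show "h * p \<in> (\<lambda>f. f w) ` J" using imageI[OF scale, of f "\<lambda>f. f w" h] w[of h] by simp
  qed
  then obtain f0 where f0: "f0 \<in> J" "\<And>f. f \<in> J \<Longrightarrow> f0 w dvd f w" by blast
  let ?J = "{f \<in> J. f w = 0}"
  have "poly_submodule V ?J" using zero add scale by (simp add: poly_submodule_def)
  moreover have "f = (\<lambda>i. 0)" if "f \<in> ?J" "\<And>i. i \<in> W \<Longrightarrow> f i = 0" for f
    using insert.prems(3)[of f] that by auto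
  ultimately obtain A where A: "A \<subseteq> ?J" "finite A"
    "\<And>K. A \<subseteq> K \<Longrightarrow> poly_submodule V K \<Longrightarrow> ?J \<subseteq> K"
    using insert.IH[of ?J] insert.prems(1) by auto
  have "J \<subseteq> K" if K: "insert f0 A \<subseteq> K" "poly_submodule V K" for K
  proof
    fix f assume f: "f \<in> J"
    obtain h where h: "f w = f0 w * h" using f0(2)[OF f] by blast
    let ?f' = "\<lambda>i. f i + diagonal V (- h) i * f0 i"
    have "?f' \<in> ?J" using add[OF f scale[OF f0(1)]] h by (simp add: w mult.commute)
    then have f': "?f' \<in> K" using A(3)[of K] K by blast
    have "(\<lambda>i. diagonal V h i * f0 i) \<in> K" using K by (simp add: poly_submodule_def)
    then have "(\<lambda>i. ?f' i + diagonal V h i * f0 i) \<in> K"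
      by (rule poly_submodule_add[OF K(2) f'])
    moreover have "(\<lambda>i. ?f' i + diagonal V h i * f0 i) = f"
      by (simp add: diagonal_def fun_eq_iff)
    ultimately show "f \<in> K" by simp
  qed
  then show ?case using A f0(1) by (intro exI[of _ "insert f0 A"]) auto
qed

lemma noetherian_axes_ring:
  assumes V: "finite V" "V \<noteq> {}"
  shows "noetherian_ring (axes_ring V :: ('v \<Rightarrow> 'k::field poly) ring)" (is "noetherian_ring ?B")
proof -
  interpret cring ?B by (rule cring_axes_ring)
  have sub: "poly_submodule V J" if "ideal J ?B" for J
  proof -
    interpret J: ideal J ?B by fact
    show ?thesis
      unfolding poly_submodule_def
      using J.zero_closed J.a_closed J.I_l_closed[OF _ diagonal_in_carrier] by simp
  qed
  show ?thesis
  proof (rule noetherian_ringI)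
    fix J assume J: "ideal J ?B"
    have JB: "J \<subseteq> carrier ?B" by (rule ideal_subset_carrier) fact
    have "f = (\<lambda>i. 0)" if "f \<in> J" "\<And>i. i \<in> V \<Longrightarrow> f i = 0" for f
      using axes_ring_eqI[OF V(2), of f "\<lambda>i. 0"] that JB zero_closed by auto
    then obtain A where A: "A \<subseteq> J" "finite A" "\<And>K. A \<subseteq> K \<Longrightarrow> poly_submodule V K \<Longrightarrow> J \<subseteq> K"
      using poly_submodule_finitely_generated[OF V(1) subset_refl sub[OF J]] by blast
    have AB: "A \<subseteq> carrier ?B" using A(1) JB by blast
    have "J = genideal ?B A"
    proof (rule equalityI)
      show "J \<subseteq> genideal ?B A"
        by (rule A(3)[OF genideal_self[OF AB] sub[OF genideal_ideal[OF AB]]])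
      show "genideal ?B A \<subseteq> J" by (rule genideal_minimal[OF J A(1)])
    qed
    then show "\<exists>A\<subseteq>carrier ?B. finite A \<and> J = genideal ?B A"
      by (intro exI[of _ A] conjI AB A(2))
  qed
qed

lemma axes_ring_nonzerodivisor:
  fixes f :: "'v \<Rightarrow> 'k::field poly"
  assumes "V \<noteq> {}" "f \<in> carrier (axes_ring V)" "\<And>i. i \<in> V \<Longrightarrow> f i \<noteq> 0"
  shows "cring.nonzerodivisor (axes_ring V) f"
proof -
  interpret cring "axes_ring V :: ('v \<Rightarrow> 'k poly) ring" by (rule cring_axes_ring)
  show ?thesis
    unfolding nonzerodivisor_def
  proof (intro conjI ballI impI)
    fix a assume a: "a \<in> carrier (axes_ring V)" "f \<otimes>\<^bsub>axes_ring V\<^esub> a = \<zero>\<^bsub>axes_ring V\<^esub>"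
    have "a i = 0" if "i \<in> V" for i
      using fun_cong[OF a(2), of i] assms(3)[OF that] by simp
    then show "a = \<zero>\<^bsub>axes_ring V\<^esub>"
      using axes_ring_eqI[OF assms(1) a(1) zero_closed] by simp
  qed fact
qed

text \<open>Elements without vanishing component on \<open>V\<close> are nonzerodivisors. The diagonal element \<open>t\<close>
  given by \<open>X\<close> is one. If it does not lie in \<open>M\<close>, then \<open>1 = f + b t\<close> for some \<open>f \<in> M\<close> by
  maximality, and all components of \<open>f\<close> have constant term 1.\<close>

lemma axes_ring_maximal_nonzerodivisor:
  fixes M :: "('v \<Rightarrow> 'k::field poly) set"
  assumes "V \<noteq> {}" "maximalideal M (axes_ring V)"
  shows "\<exists>f\<in>M. cring.nonzerodivisor (axes_ring V) f"
proof -
  let ?B = "axes_ring V :: ('v \<Rightarrow> 'k poly) ring"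
  interpret cring ?B by (rule cring_axes_ring)
  interpret M: maximalideal M ?B by fact
  let ?t = "diagonal V [:0, 1:] :: 'v \<Rightarrow> 'k poly"
  have t: "?t \<in> carrier ?B" by (rule diagonal_in_carrier)
  show ?thesis
  proof (cases "?t \<in> M")
    case True
    moreover have "nonzerodivisor ?t"
      by (rule axes_ring_nonzerodivisor[OF assms(1) t]) (simp add: diagonal_def)
    ultimately show ?thesis by blast
  next
    case False
    let ?J = "set_add ?B M (cgenideal ?B ?t)"
    have J: "ideal ?J ?B" by (rule add_ideals[OF M.is_ideal cgenideal_ideal[OF t]])
    have "M \<subseteq> ?J"
    proof
      fix f assume "f \<in> M"
      moreover have "\<zero>\<^bsub>?B\<^esub> \<in> cgenideal ?B ?t"
        by (rule additive_subgroup.zero_closed[OF ideal.axioms(1)[OF cgenideal_ideal[OF t]]])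
      ultimately show "f \<in> ?J" unfolding set_add_def' by force
    qed
    moreover have "?t \<in> ?J"
      using M.zero_closed cgenideal_self[OF t] unfolding set_add_def' by force
    ultimately have "?J = carrier ?B"
      using M.I_maximal[OF J] ideal_subset_carrier[OF J] False by blast
    then have "\<one>\<^bsub>?B\<^esub> \<in> ?J" using one_closed by simp
    then obtain f b where fb: "f \<in> M" "b \<in> carrier ?B" "(\<lambda>i. 1) = (\<lambda>i. f i + b i * ?t i)"
      unfolding set_add_def' cgenideal_def by auto
    have "f i \<noteq> 0" if "i \<in> V" for i
    proof
      assume "f i = 0"
      then have "1 = b i * [:0, 1:]" using fun_cong[OF fb(3), of i] that by (simp add: diagonal_def)
      from arg_cong[OF this, of "\<lambda>p. coeff p 0"] show False by (simp add: coeff_mult_0)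
    qed
    then have "nonzerodivisor f"
      using axes_ring_nonzerodivisor[OF assms(1) M.Icarr[OF fb(1)]] by blast
    then show ?thesis using fb(1) by blast
  qed
qed

lemma axes_ring_pow: "f [^]\<^bsub>axes_ring V\<^esub> (n::nat) = (\<lambda>i. f i ^ n)"
  by (induction n) (simp_all add: nat_pow_def mult.commute)

text \<open>On each axis \<open>i\<close> with \<open>a i \<noteq> 0\<close> there is a nonzero \<open>Q i\<close> such that \<open>Q i\<close>, evaluated at
  \<open>b i\<close>, is divisible by \<open>a i\<close>. The product of these polynomials serves all axes at once. Its
  coefficients are constants, so the resulting \<open>y = r(b)\<close> is again an element of the ring of the
  axes. On the remaining axes the identity holds because of the factor \<open>a\<close> in front.\<close>

lemma axes_ring_collapses:
  fixes a b :: "'v \<Rightarrow> 'k::field poly"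
  assumes V: "finite V" "V \<noteq> {}" and a: "a \<in> carrier (axes_ring V)" and b: "b \<in> carrier (axes_ring V)"
  shows "cring.collapses (axes_ring V) a b"
proof -
  let ?B = "axes_ring V :: ('v \<Rightarrow> 'k poly) ring"
  interpret cring ?B by (rule cring_axes_ring)
  let ?X = "[:0, 1:] :: 'k poly"
  (* The additional factor X makes x vanish at the origin on every axis, so that x is an
     element of the ring of the axes. *)
  have "\<exists>q. q \<noteq> 0 \<and> a i * ?X dvd pcompose q (b i)" if "a i \<noteq> 0" for i
    using that algebraic_modulo[of "a i * ?X" "b i"] by (simp only: mult_eq_0_iff) simp
  then obtain Q where Q: "\<And>i. a i \<noteq> 0 \<Longrightarrow> Q i \<noteq> 0" "\<And>i. a i \<noteq> 0 \<Longrightarrow> a i * ?X dvd pcompose (Q i) (b i)"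
    by metis
  define q0 where "q0 = (\<Prod>i\<in>{i\<in>V. a i \<noteq> 0}. Q i)"
  have "q0 \<noteq> 0" using Q(1) V(1) by (simp add: q0_def)
  then obtain c m r where q: "c \<noteq> 0" "smult c q0 = monom 1 m * pCons 1 r"
    using nonzero_poly_lowest_term by blast
  have "\<exists>k. b i ^ m * (1 + b i * pcompose r (b i)) = a i * ?X * k" if i: "i \<in> V" "a i \<noteq> 0" for i
  proof -
    have "Q i dvd q0" using i V(1) by (auto simp: q0_def intro: dvd_prodI)
    then have "Q i dvd smult c q0" by (rule dvd_smult)
    then obtain s where "monom 1 m * pCons 1 r = Q i * s" unfolding q(2) by blast
    then have "pcompose (monom 1 m * pCons 1 r) (b i) = pcompose (Q i) (b i) * pcompose s (b i)"
      by (simp add: pcompose_mult)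
    then have "a i * ?X dvd pcompose (monom 1 m * pCons 1 r) (b i)" using Q(2)[OF i(2)] by simp
    moreover have "pcompose (monom 1 m * pCons 1 r) (b i) = b i ^ m * (1 + b i * pcompose r (b i))"
      by (simp only: pcompose_mult pcompose_monom pcompose_pCons one_pCons smult_1_left)
    ultimately show ?thesis unfolding dvd_def by simp
  qed
  then obtain k where k: "\<And>i. i \<in> V \<Longrightarrow> a i \<noteq> 0 \<Longrightarrow>
      b i ^ m * (1 + b i * pcompose r (b i)) = a i * ?X * k i"
    by metis
  define x where "x = (\<lambda>i. if i \<in> V \<and> a i \<noteq> 0 then - (?X * k i) else 0)"
  define y where "y = (\<lambda>i. pcompose r (b i))"
  have x: "x \<in> carrier ?B"
    unfolding axes_ring_carrier by (intro exI[of _ 0]) (simp add: x_def coeff_mult_0)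
  have y: "y \<in> carrier ?B" unfolding y_def by (rule axes_ring_pcompose_closed[OF b])
  have "a [^]\<^bsub>?B\<^esub> (1::nat) \<otimes>\<^bsub>?B\<^esub> (b [^]\<^bsub>?B\<^esub> m \<otimes>\<^bsub>?B\<^esub> (\<one>\<^bsub>?B\<^esub> \<oplus>\<^bsub>?B\<^esub> b \<otimes>\<^bsub>?B\<^esub> y) \<oplus>\<^bsub>?B\<^esub> a \<otimes>\<^bsub>?B\<^esub> x) = \<zero>\<^bsub>?B\<^esub>"
  proof (rule axes_ring_eqI[OF V(2)])
    fix i assume i: "i \<in> V"
    show "(a [^]\<^bsub>?B\<^esub> (1::nat) \<otimes>\<^bsub>?B\<^esub> (b [^]\<^bsub>?B\<^esub> m \<otimes>\<^bsub>?B\<^esub> (\<one>\<^bsub>?B\<^esub> \<oplus>\<^bsub>?B\<^esub> b \<otimes>\<^bsub>?B\<^esub> y) \<oplus>\<^bsub>?B\<^esub> a \<otimes>\<^bsub>?B\<^esub> x)) i = \<zero>\<^bsub>?B\<^esub> i"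
    proof (cases "a i = 0")
      case True then show ?thesis by (simp only: axes_ring_simps axes_ring_pow) simp
    next
      case False
      then show ?thesis using k[OF i False] i
        by (simp only: axes_ring_simps axes_ring_pow y_def x_def) simp
    qed
  qed (intro m_closed a_closed nat_pow_closed one_closed zero_closed a b x y)+
  then show ?thesis unfolding collapses_def using x y by blast
qed

theorem cohen_macaulay_axes_ring:
  assumes "finite V" "V \<noteq> {}"
  shows "cohen_macaulay_ring (axes_ring V :: ('v \<Rightarrow> 'k::field poly) ring)"
proof -
  interpret cring "axes_ring V :: ('v \<Rightarrow> 'k poly) ring" by (rule cring_axes_ring)
  show ?thesis
  proof (rule cohen_macaulay_ring_criterion)
    show "noetherian_ring (axes_ring V :: ('v \<Rightarrow> 'k poly) ring)"
      by (rule noetherian_axes_ring) fact+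
    show "\<exists>f\<in>M. nonzerodivisor f" if "maximalideal M (axes_ring V)" for M
      by (rule axes_ring_maximal_nonzerodivisor) fact+
    show "\<forall>a\<in>carrier (axes_ring V). \<forall>b\<in>carrier (axes_ring V). collapses a b"
      by (intro ballI axes_ring_collapses assms)
  qed
qed

section \<open>Stanley--Reisner rings of discrete sets of points\<close>

abbreviation lookup where "lookup \<equiv> Poly_Mapping.lookup"
abbreviation keys where "keys \<equiv> Poly_Mapping.keys"
abbreviation single where "single \<equiv> Poly_Mapping.single"

lemma polynomial_ring_simps [simp]:
  "mult (polynomial_ring V) = (*)" "one (polynomial_ring V) = 1"
  "zero (polynomial_ring V) = 0" "add (polynomial_ring V) = (+)"
  by (simp_all add: polynomial_ring_def)

lemma polynomial_ring_carrier:
  "p \<in> carrier (polynomial_ring V) \<longleftrightarrow> (\<forall>m\<in>keys p. keys m \<subseteq> V)"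
  by (simp add: polynomial_ring_def)

lemma keys_add_exponents: "keys (m + m' :: 'v \<Rightarrow>\<^sub>0 nat) = keys m \<union> keys m'"
  by (auto simp: in_keys_iff lookup_add)

lemma polynomial_ring_single: "keys m \<subseteq> V \<Longrightarrow> single m c \<in> carrier (polynomial_ring V)"
  by (simp add: polynomial_ring_carrier)

lemma cring_polynomial_ring: "cring (polynomial_ring V :: (('v \<Rightarrow>\<^sub>0 nat) \<Rightarrow>\<^sub>0 'k::field) ring)"
proof (rule cringI)
  have add: "p + q \<in> carrier (polynomial_ring V)"
    if "p \<in> carrier (polynomial_ring V)" "q \<in> carrier (polynomial_ring V)"
    for p q :: "('v \<Rightarrow>\<^sub>0 nat) \<Rightarrow>\<^sub>0 'k"
    using that keys_add[of p q] unfolding polynomial_ring_carrier by blast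
  have mult: "p * q \<in> carrier (polynomial_ring V)"
    if "p \<in> carrier (polynomial_ring V)" "q \<in> carrier (polynomial_ring V)"
    for p q :: "('v \<Rightarrow>\<^sub>0 nat) \<Rightarrow>\<^sub>0 'k"
    unfolding polynomial_ring_carrier
  proof
    fix m assume "m \<in> keys (p * q)"
    then obtain a b where "m = a + b" "a \<in> keys p" "b \<in> keys q" using keys_mult[of p q] by blast
    moreover have "keys (a + b) = keys a \<union> keys b" by (rule keys_add_exponents)
    ultimately show "keys m \<subseteq> V"
      using that unfolding polynomial_ring_carrier by blast
  qed
  show "abelian_group (polynomial_ring V :: (('v \<Rightarrow>\<^sub>0 nat) \<Rightarrow>\<^sub>0 'k::field) ring)"
  proof (rule abelian_groupI)
    fix p :: "('v \<Rightarrow>\<^sub>0 nat) \<Rightarrow>\<^sub>0 'k" assume "p \<in> carrier (polynomial_ring V)"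
    then have "- p \<in> carrier (polynomial_ring V)" by (simp add: polynomial_ring_carrier in_keys_iff)
    then show "\<exists>q\<in>carrier (polynomial_ring V). q \<oplus>\<^bsub>polynomial_ring V\<^esub> p = \<zero>\<^bsub>polynomial_ring V\<^esub>"
      by (rule bexI[rotated]) simp
  qed (simp_all add: add ac_simps, simp add: polynomial_ring_carrier)
  show "comm_monoid (polynomial_ring V :: (('v \<Rightarrow>\<^sub>0 nat) \<Rightarrow>\<^sub>0 'k::field) ring)"
    by (rule comm_monoidI) (simp_all add: mult ac_simps, simp add: polynomial_ring_carrier)
qed (simp add: algebra_simps)

lemma polynomial_ring_ideal_sum_closed:
  assumes "ideal I (polynomial_ring V)" "\<And>x. x \<in> A \<Longrightarrow> g x \<in> I"
  shows "sum g A \<in> I"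
proof -
  have zero: "0 \<in> I" and add: "\<And>x y. x \<in> I \<Longrightarrow> y \<in> I \<Longrightarrow> x + y \<in> I"
    using additive_subgroup.zero_closed[OF ideal.axioms(1)[OF assms(1)]]
      additive_subgroup.a_closed[OF ideal.axioms(1)[OF assms(1)]] by simp_all
  then show ?thesis
    using assms(2) by (induction A rule: infinite_finite_induct) auto
qed

lemma poly_mapping_sum_single: "p = (\<Sum>m\<in>keys p. single m (lookup p m))"
proof (rule poly_mapping_eqI)
  fix k
  have "lookup (\<Sum>m\<in>keys p. single m (lookup p m)) k = (\<Sum>m\<in>keys p. if m = k then lookup p m else 0)"
    by (auto simp: lookup_sum lookup_single when_def intro!: sum.cong)
  also have "\<dots> = lookup p k" by (simp add: in_keys_iff)
  finally show "lookup p k = lookup (\<Sum>m\<in>keys p. single m (lookup p m)) k" by simp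
qed

lemma multiplicative_on_monomials_imp_multiplicative:
  fixes \<phi> :: "('m::comm_monoid_add \<Rightarrow>\<^sub>0 'k::comm_ring_1) \<Rightarrow> 'c::comm_ring_1"
  assumes add: "\<And>p q. \<phi> (p + q) = \<phi> p + \<phi> q"
    and mult: "\<And>a b c d. \<phi> (single a c * single b d) = \<phi> (single a c) * \<phi> (single b d)"
  shows "\<phi> (p * q) = \<phi> p * \<phi> q"
proof -
  have zero: "\<phi> 0 = 0" using add[of 0 0] by simp
  have sum: "\<phi> (sum g A) = (\<Sum>x\<in>A. \<phi> (g x))" for g :: "'m \<Rightarrow> _" and A
    by (induction A rule: infinite_finite_induct) (simp_all add: zero add)
  let ?P = "\<Sum>a\<in>keys p. single a (lookup p a)" and ?Q = "\<Sum>b\<in>keys q. single b (lookup q b)"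
  have "\<phi> (?P * ?Q) = \<phi> ?P * \<phi> ?Q"
    by (simp add: sum_product sum mult)
  then show ?thesis by (simp flip: poly_mapping_sum_single)
qed

lemma lookup_squarefree_exponent:
  "finite F \<Longrightarrow> lookup (\<Sum>v\<in>F. single v (1::nat)) w = (if w \<in> F then 1 else 0)"
  by (simp add: lookup_sum lookup_single when_def)

lemma keys_squarefree_exponent: "finite F \<Longrightarrow> keys (\<Sum>v\<in>F. single v (1::nat)) = F"
  by (auto simp: in_keys_iff lookup_squarefree_exponent simp del: One_nat_def split: if_splits)

lemma squarefree_monomial_in_carrier:
  "finite V \<Longrightarrow> F \<subseteq> V \<Longrightarrow> squarefree_monomial F \<in> carrier (polynomial_ring V)"
  unfolding squarefree_monomial_def
  by (intro polynomial_ring_single) (simp add: keys_squarefree_exponent finite_subset del: One_nat_def)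

definition nonface_monomials :: "'v set \<Rightarrow> 'v set set \<Rightarrow> (('v \<Rightarrow>\<^sub>0 nat) \<Rightarrow>\<^sub>0 'k::field) set" where
  "nonface_monomials V \<Delta> = {squarefree_monomial F | F. F \<subseteq> V \<and> F \<notin> \<Delta>}"

lemma stanley_reisner_ring_eq:
  "stanley_reisner_ring V \<Delta> = polynomial_ring V Quot genideal (polynomial_ring V) (nonface_monomials V \<Delta>)"
  by (simp add: stanley_reisner_ring_def nonface_monomials_def)

lemma nonface_monomials_subset: "finite V \<Longrightarrow> nonface_monomials V \<Delta> \<subseteq> carrier (polynomial_ring V)"
  using squarefree_monomial_in_carrier by (auto simp: nonface_monomials_def)

lemma cring_stanley_reisner_ring:
  assumes "finite V"
  shows "cring (stanley_reisner_ring V \<Delta> :: (('v \<Rightarrow>\<^sub>0 nat) \<Rightarrow>\<^sub>0 'k::field) set ring)"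
proof -
  interpret cring "polynomial_ring V :: (('v \<Rightarrow>\<^sub>0 nat) \<Rightarrow>\<^sub>0 'k) ring" by (rule cring_polynomial_ring)
  show ?thesis
    unfolding stanley_reisner_ring_eq
    by (intro ideal.quotient_is_cring genideal_ideal nonface_monomials_subset assms is_cring)
qed

text \<open>The substitution of 0 for all variables except \<open>i\<close>: the monomials that survive are the powers
  of the variable \<open>i\<close>.\<close>

definition axis_restriction :: "(('v \<Rightarrow>\<^sub>0 nat) \<Rightarrow>\<^sub>0 'k::field) \<Rightarrow> 'v \<Rightarrow> 'k poly" where
  "axis_restriction p i = Abs_poly (\<lambda>n. lookup p (single i n))"

lemma coeff_axis_restriction: "coeff (axis_restriction p i) n = lookup p (single i n)"
proof -
  have "inj (\<lambda>n. single i (n :: nat))" by (rule injI) (metis lookup_single_eq)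
  then have "finite {n. single i n \<in> keys p}"
    using finite_vimageI[of "keys p" "\<lambda>n. single i n"] by (simp add: vimage_def)
  then have "finite {n. lookup p (single i n) \<noteq> 0}" by (simp add: in_keys_iff)
  then have "\<forall>\<^sub>\<infinity> n. lookup p (single i n) = 0" by (simp add: eventually_cofinite)
  then show ?thesis by (simp add: axis_restriction_def Abs_poly_inverse)
qed

lemma axis_restriction_add: "axis_restriction (p + q) i = axis_restriction p i + axis_restriction q i"
  by (rule poly_eqI) (simp add: coeff_axis_restriction lookup_add)

lemma eq_single_iff: "m = single i n \<longleftrightarrow> keys m \<subseteq> {i} \<and> n = lookup m i" for m :: "'v \<Rightarrow>\<^sub>0 nat"
proof
  assume m: "keys m \<subseteq> {i} \<and> n = lookup m i"
  show "m = single i n"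
  proof (rule poly_mapping_eqI)
    fix k show "lookup m k = lookup (single i n) k"
      using m by (cases "k = i") (auto simp: lookup_single when_def in_keys_iff)
  qed
qed auto

lemma single_Suc_neq_zero: "single i (Suc n) \<noteq> 0"
  by (metis lookup_single_eq lookup_zero nat.distinct(1))

lemma axis_restriction_single:
  "axis_restriction (single m c) i = (if keys m \<subseteq> {i} then monom c (lookup m i) else 0)"
  by (rule poly_eqI) (auto simp: coeff_axis_restriction lookup_single when_def eq_single_iff)

lemma axis_restriction_mult: "axis_restriction (p * q) i = axis_restriction p i * axis_restriction q i"
proof (rule multiplicative_on_monomials_imp_multiplicative[where \<phi> = "\<lambda>p. axis_restriction p i"])
  fix a b c d
  show "axis_restriction (single a c * single b d) i = axis_restriction (single a c) i * axis_restriction (single b d) i"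
    by (auto simp: mult_single axis_restriction_single keys_add_exponents mult_monom lookup_add)
qed (rule axis_restriction_add)

lemma axis_restriction_in_carrier:
  assumes "p \<in> carrier (polynomial_ring V)"
  shows "axis_restriction p \<in> carrier (axes_ring V)"
  unfolding axes_ring_carrier
proof (intro exI[of _ "lookup p 0"] conjI allI impI)
  fix i show "coeff (axis_restriction p i) 0 = lookup p 0" by (simp add: coeff_axis_restriction)
next
  fix i assume i: "i \<notin> V"
  have "lookup p (single i n) = 0" if "n \<noteq> 0" for n
  proof -
    have "keys (single i n) = {i}" using that by simp
    then have "single i n \<notin> keys p" using assms i unfolding polynomial_ring_carrier by auto
    then show ?thesis by (simp add: in_keys_iff)
  qed
  then show "axis_restriction p i = [:lookup p 0:]"
    by (intro poly_eqI) (auto simp: coeff_axis_restriction coeff_pCons split: nat.splits)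
qed

lemma axis_restriction_hom:
  "axis_restriction \<in> ring_hom (polynomial_ring V) (axes_ring V)"
proof (rule ring_hom_memI)
  show "axis_restriction \<one>\<^bsub>polynomial_ring V\<^esub> = \<one>\<^bsub>axes_ring V\<^esub>"
  proof
    fix i show "axis_restriction \<one>\<^bsub>polynomial_ring V\<^esub> i = \<one>\<^bsub>axes_ring V\<^esub> i"
      using axis_restriction_single[of 0 1 i] by (simp add: monom_0 one_pCons)
  qed
qed (simp_all add: axis_restriction_in_carrier axis_restriction_mult axis_restriction_add fun_eq_iff)

lemma axis_restriction_surj:
  assumes V: "finite V" and f: "f \<in> carrier (axes_ring V)"
  shows "\<exists>p\<in>carrier (polynomial_ring V). axis_restriction p = f"
proof -
  obtain c where c: "\<And>i. coeff (f i) 0 = c" "\<And>i. i \<notin> V \<Longrightarrow> f i = [:c:]"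
    using f unfolding axes_ring_carrier by blast
  define d where "d i = Polynomial.degree (f i)" for i
  (* The inner sum starts at 1 because the constant term is common to all axes. *)
  define p where "p = single 0 c + (\<Sum>i\<in>V. \<Sum>n\<in>{1..d i}. single (single i n) (coeff (f i) n))"
  have "p \<in> carrier (polynomial_ring V)"
    unfolding polynomial_ring_carrier
  proof
    fix m assume "m \<in> keys p"
    then have "m \<in> keys (single 0 c :: ('a \<Rightarrow>\<^sub>0 nat) \<Rightarrow>\<^sub>0 'b) \<or>
        (\<exists>i\<in>V. \<exists>n\<in>{1..d i}. m \<in> keys (single (single i n) (coeff (f i) n)))"
      unfolding p_def using keys_add keys_sum by (smt (verit, ccfv_threshold) UN_iff UnE subsetD)
    then show "keys m \<subseteq> V" by (auto split: if_splits)
  qed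
  moreover have "axis_restriction p j = f j" for j
  proof (rule poly_eqI)
    fix k
    have *: "lookup (single (single i n) (coeff (f i) n)) (single j k) =
        (if i = j then if n = k then coeff (f j) k else 0 else 0)" if "n \<in> {1..d i}" for i n
      using that by (auto simp: lookup_single when_def eq_single_iff split: if_splits)
    have "coeff (axis_restriction p j) k = (c when (single j k = 0)) +
        (\<Sum>i\<in>V. if i = j then \<Sum>n\<in>{1..d i}. if n = k then coeff (f j) k else 0 else 0)"
      unfolding coeff_axis_restriction p_def lookup_add lookup_sum lookup_single[of 0]
      by (intro arg_cong2[of _ _ _ _ "(+)"] sum.cong refl) (auto simp: when_def * intro!: sum.neutral sum.cong)
    also have "\<dots> = coeff (f j) k"
      using c V by (cases k) (auto simp: when_def single_Suc_neq_zero d_def coeff_pCons not_le coeff_eq_0 split: nat.splits)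
    finally show "coeff (axis_restriction p j) k = coeff (f j) k" .
  qed
  ultimately show ?thesis by (intro bexI[of _ p]) auto
qed

text \<open>A monomial in at most one variable survives on the axis of that variable, and distinct
  monomials in this variable remain distinct there. So a polynomial in the kernel involves only
  monomials with at least two variables \<open>u\<close> and \<open>v\<close>, which are multiples of the generator given by
  the nonface \<open>{u, v}\<close>.\<close>

lemma kernel_axis_restriction:
  assumes V: "finite V" and \<Delta>: "\<And>F. F \<subseteq> V \<Longrightarrow> F \<in> \<Delta> \<longleftrightarrow> (\<forall>u\<in>F. \<forall>v\<in>F. u = v)"
  shows "a_kernel (polynomial_ring V) (axes_ring V) axis_restriction =
    genideal (polynomial_ring V) (nonface_monomials V \<Delta> :: (('v \<Rightarrow>\<^sub>0 nat) \<Rightarrow>\<^sub>0 'k::field) set)"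
    (is "?K = ?I")
proof -
  let ?P = "polynomial_ring V :: (('v \<Rightarrow>\<^sub>0 nat) \<Rightarrow>\<^sub>0 'k) ring"
  interpret P: cring ?P by (rule cring_polynomial_ring)
  interpret B: cring "axes_ring V :: ('v \<Rightarrow> 'k poly) ring" by (rule cring_axes_ring)
  interpret h: ring_hom_ring ?P "axes_ring V" axis_restriction
    by (rule ring_hom_ringI2) (simp_all add: P.ring_axioms B.ring_axioms axis_restriction_hom)
  have sub: "nonface_monomials V \<Delta> \<subseteq> carrier ?P" by (rule nonface_monomials_subset[OF V])
  have I: "ideal ?I ?P" by (rule P.genideal_ideal[OF sub])
  have K: "?K = {p \<in> carrier ?P. axis_restriction p = (\<lambda>i. 0)}"
    unfolding a_kernel_def' axes_ring_simps by (rule refl)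
  show ?thesis
  proof (rule equalityI)
    show "?I \<subseteq> ?K"
    proof (rule P.genideal_minimal[OF h.kernel_is_ideal], rule subsetI)
      fix p :: "('v \<Rightarrow>\<^sub>0 nat) \<Rightarrow>\<^sub>0 'k" assume p: "p \<in> nonface_monomials V \<Delta>"
      then obtain F where F: "p = squarefree_monomial F" "F \<subseteq> V" "F \<notin> \<Delta>"
        by (auto simp: nonface_monomials_def)
      then have "finite F" "\<not> F \<subseteq> {i}" for i using V \<Delta>[of F] finite_subset by (blast, blast)
      then have "axis_restriction p = (\<lambda>i. 0)"
        by (simp add: F(1) squarefree_monomial_def axis_restriction_single keys_squarefree_exponent fun_eq_iff
            del: One_nat_def)
      then show "p \<in> ?K" using p sub K by blast
    qed
    show "?K \<subseteq> ?I"
    proof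
      fix p assume "p \<in> ?K"
      then have p: "p \<in> carrier ?P" "axis_restriction p = (\<lambda>i. 0)" using K by auto
      have mono: "single m (lookup p m) \<in> ?I" if m: "m \<in> keys p" for m
      proof -
        have mV: "keys m \<subseteq> V" using p(1) m by (simp add: polynomial_ring_carrier)
        have nle: "\<not> keys m \<subseteq> {i}" for i
        proof
          assume "keys m \<subseteq> {i}"
          then have "m = single i (lookup m i)" by (simp add: eq_single_iff)
          then have "lookup p m = coeff (axis_restriction p i) (lookup m i)"
            by (metis coeff_axis_restriction)
          then show False using p(2) m by (simp add: in_keys_iff)
        qed
        then obtain u where u: "u \<in> keys m" by blast
        then obtain v where v: "v \<in> keys m" "v \<noteq> u" using nle[of u] by blast
        define e where "e = (\<Sum>w\<in>{u, v}. single w (1::nat))"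
        have e: "lookup e k = (if k \<in> {u, v} then 1 else 0)" for k
          unfolding e_def by (rule lookup_squarefree_exponent) simp
        have "m = e + (m - e)"
        proof (rule poly_mapping_eqI)
          fix k show "lookup m k = lookup (e + (m - e)) k"
            using u v by (auto simp: lookup_add lookup_minus e in_keys_iff)
        qed
        then have eq: "squarefree_monomial {u, v} * single (m - e) (lookup p m) = single m (lookup p m)"
          unfolding squarefree_monomial_def mult_single e_def[symmetric] by simp
        have "{u, v} \<subseteq> V" "{u, v} \<notin> \<Delta>" using u v mV \<Delta>[of "{u, v}"] by auto
        then have "squarefree_monomial {u, v} \<in> nonface_monomials V \<Delta>"
          unfolding nonface_monomials_def by blast
        then have sq: "squarefree_monomial {u, v} \<in> ?I" by (rule subsetD[OF P.genideal_self[OF sub]])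
        have "keys (m - e) \<subseteq> keys m" by (auto simp: in_keys_iff lookup_minus)
        then have "single (m - e) (lookup p m) \<in> carrier ?P"
          using mV by (intro polynomial_ring_single) simp
        from ideal.I_r_closed[OF I sq this] show ?thesis unfolding polynomial_ring_simps eq .
      qed
      have "(\<Sum>m\<in>keys p. single m (lookup p m)) \<in> ?I"
        by (rule polynomial_ring_ideal_sum_closed[OF I mono])
      then show "p \<in> ?I" unfolding poly_mapping_sum_single[of p, symmetric] .
    qed
  qed
qed

text \<open>By the hypothesis on \<open>\<Delta>\<close>, its faces within \<open>V\<close> are the empty set and the single points.\<close>

theorem cohen_macaulay_stanley_reisner_points:
  assumes V: "finite V" "V \<noteq> {}" and \<Delta>: "\<And>F. F \<subseteq> V \<Longrightarrow> F \<in> \<Delta> \<longleftrightarrow> (\<forall>u\<in>F. \<forall>v\<in>F. u = v)"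
  shows "cohen_macaulay_ring (stanley_reisner_ring V \<Delta> :: (('v \<Rightarrow>\<^sub>0 nat) \<Rightarrow>\<^sub>0 'k::field) set ring)"
proof -
  let ?P = "polynomial_ring V :: (('v \<Rightarrow>\<^sub>0 nat) \<Rightarrow>\<^sub>0 'k) ring"
  let ?SR = "stanley_reisner_ring V \<Delta> :: (('v \<Rightarrow>\<^sub>0 nat) \<Rightarrow>\<^sub>0 'k) set ring"
  interpret P: cring ?P by (rule cring_polynomial_ring)
  interpret B: cring "axes_ring V :: ('v \<Rightarrow> 'k poly) ring" by (rule cring_axes_ring)
  interpret h: ring_hom_ring ?P "axes_ring V" axis_restriction
    by (rule ring_hom_ringI2) (simp_all add: P.ring_axioms B.ring_axioms axis_restriction_hom)
  have ker: "a_kernel ?P (axes_ring V) axis_restriction = genideal ?P (nonface_monomials V \<Delta>)"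
    by (rule kernel_axis_restriction[OF V(1)]) (rule \<Delta>)
  have "axis_restriction ` carrier ?P = carrier (axes_ring V)"
    using axis_restriction_surj[OF V(1)] axis_restriction_in_carrier by blast
  then have "?SR \<simeq> (axes_ring V :: ('v \<Rightarrow> 'k poly) ring)"
    unfolding stanley_reisner_ring_eq ker[symmetric] by (rule h.FactRing_iso)
  then have "(axes_ring V :: ('v \<Rightarrow> 'k poly) ring) \<simeq> ?SR"
    by (rule ring_iso_sym[OF cring.axioms(1)[OF cring_stanley_reisner_ring[OF V(1)]]])
  then show ?thesis
    by (rule cohen_macaulay_ring_iso[OF B.is_cring cring_stanley_reisner_ring[OF V(1)] _
          cohen_macaulay_axes_ring[OF V]])
qed

section \<open>Renaming the vertices of a complex\<close>

lemma (in cring_iso) quotient_iso: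
  assumes I: "ideal I R"
  shows "R Quot I \<simeq> S Quot (h ` I)"
proof -
  let ?J = "h ` I"
  let ?k = "a_r_coset S ?J \<circ> h"
  have J: "ideal ?J S" by (rule ideal_image[OF I])
  have Q: "cring (S Quot ?J)" by (rule ideal.quotient_is_cring[OF J S.is_cring])
  have "h \<in> ring_hom R S" using iso by (simp add: ring_iso_def)
  then have "?k \<in> ring_hom R (S Quot ?J)"
    using ideal.rcos_ring_hom[OF J] by (rule ring_hom_trans)
  then interpret k: ring_hom_ring R "S Quot ?J" ?k
    by (intro ring_hom_ringI2 R.ring_axioms cring.axioms(1)[OF Q])
  have "a_kernel R (S Quot ?J) ?k = {a \<in> carrier R. h a \<in> ?J}"
    unfolding a_kernel_def'
    using ideal.rcos_const_imp_mem[OF J] S.a_rcos_zero[OF J] by (auto simp: FactRing_def)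
  also have "\<dots> = I"
    using mem_image_iff[OF ideal_subset_carrier[OF I]] ideal_subset_carrier[OF I] by blast
  finally have ker: "a_kernel R (S Quot ?J) ?k = I" .
  have "?k ` carrier R = carrier (S Quot ?J)"
    unfolding image_comp[symmetric] image_carrier by (auto simp: FactRing_def A_RCOSETS_def')
  from k.FactRing_iso[OF this] show ?thesis unfolding ker .
qed

definition rename_exponent :: "('a \<Rightarrow> 'b) \<Rightarrow> ('a \<Rightarrow>\<^sub>0 nat) \<Rightarrow> ('b \<Rightarrow>\<^sub>0 nat)" where
  "rename_exponent f m = (\<Sum>v\<in>keys m. single (f v) (lookup m v))"

text \<open>For injective \<open>f\<close>, this substitutes the variable \<open>v\<close> for \<open>f v\<close> and 0 for every variable
  outside the range of \<open>f\<close>. On polynomials in the variables \<open>f ` V\<close> it is inverse to renaming the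
  variables along \<open>f\<close>.\<close>

definition rename_back :: "('a \<Rightarrow> 'b) \<Rightarrow> (('b \<Rightarrow>\<^sub>0 nat) \<Rightarrow>\<^sub>0 'k::field) \<Rightarrow> (('a \<Rightarrow>\<^sub>0 nat) \<Rightarrow>\<^sub>0 'k)" where
  "rename_back f = Poly_Mapping.map_key (rename_exponent f)"

context
  fixes f :: "'a \<Rightarrow> 'b"
  assumes f: "inj f"
begin

lemma lookup_rename_exponent: "lookup (rename_exponent f m) (f v) = lookup m v"
proof -
  have "lookup (rename_exponent f m) (f v) = (\<Sum>w\<in>keys m. if w = v then lookup m w else 0)"
    by (auto simp: rename_exponent_def lookup_sum lookup_single when_def inj_eq[OF f] intro!: sum.cong)
  also have "\<dots> = lookup m v" by (simp add: in_keys_iff)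
  finally show ?thesis .
qed

lemma lookup_rename_exponent_outside: "w \<notin> range f \<Longrightarrow> lookup (rename_exponent f m) w = 0"
  by (auto simp: rename_exponent_def lookup_sum lookup_single when_def intro!: sum.neutral)

lemma keys_rename_exponent: "keys (rename_exponent f m) = f ` keys m"
proof -
  have "w \<in> keys (rename_exponent f m) \<longleftrightarrow> w \<in> f ` keys m" for w
    by (cases "w \<in> range f")
      (auto simp: in_keys_iff lookup_rename_exponent lookup_rename_exponent_outside inj_eq[OF f])
  then show ?thesis by blast
qed

lemma rename_exponent_eqI:
  assumes "keys m' \<subseteq> range f" "\<And>v. lookup m' (f v) = lookup m v"
  shows "rename_exponent f m = m'"
proof (rule poly_mapping_eqI)
  fix w show "lookup (rename_exponent f m) w = lookup m' w"
  proof (cases "w \<in> range f")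
    case True then show ?thesis using assms(2) lookup_rename_exponent by auto
  next
    case False then show ?thesis
      using assms(1) lookup_rename_exponent_outside by (auto simp: in_keys_iff)
  qed
qed

lemma inj_rename_exponent: "inj (rename_exponent f)"
proof (rule injI, rule poly_mapping_eqI)
  fix m m' v assume "rename_exponent f m = rename_exponent f m'"
  then show "lookup m v = lookup m' v"
    using lookup_rename_exponent[of m v] lookup_rename_exponent[of m' v] by simp
qed

lemma rename_exponent_add: "rename_exponent f (m + m') = rename_exponent f m + rename_exponent f m'"
  by (rule rename_exponent_eqI)
    (auto simp: keys_add_exponents keys_rename_exponent lookup_add lookup_rename_exponent)

lemma rename_exponent_surj:
  assumes "keys m' \<subseteq> range f"
  obtains m where "m' = rename_exponent f m"
proof
  show "m' = rename_exponent f (Poly_Mapping.map_key f m')"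
    by (rule rename_exponent_eqI[symmetric]) (use assms f in \<open>simp_all add: map_key.rep_eq\<close>)
qed

lemma rename_exponent_squarefree:
  assumes "finite F"
  shows "rename_exponent f (\<Sum>v\<in>F. single v 1) = (\<Sum>w\<in>f ` F. single w 1)"
proof (rule rename_exponent_eqI)
  show "keys (\<Sum>w\<in>f ` F. single w (1::nat)) \<subseteq> range f"
    using keys_squarefree_exponent[of "f ` F"] assms by auto
  show "lookup (\<Sum>w\<in>f ` F. single w (1::nat)) (f v) = lookup (\<Sum>v\<in>F. single v 1) v" for v
    using assms by (simp add: lookup_squarefree_exponent inj_image_mem_iff[OF f] del: One_nat_def)
qed

lemma lookup_rename_back: "lookup (rename_back f p) m = lookup p (rename_exponent f m)"
  by (simp add: rename_back_def map_key.rep_eq inj_rename_exponent)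

lemma rename_back_add: "rename_back f (p + q) = rename_back f p + rename_back f q"
  by (simp add: rename_back_def map_key_plus inj_rename_exponent)

lemma rename_back_single: "rename_back f (single (rename_exponent f m) c) = single m c"
  by (simp add: rename_back_def inj_rename_exponent)

lemma rename_back_single_outside:
  assumes "\<not> keys m' \<subseteq> range f"
  shows "rename_back f (single m' c) = 0"
proof (rule poly_mapping_eqI)
  fix m
  have "m' \<noteq> rename_exponent f m" using assms keys_rename_exponent[of m] by auto
  then show "lookup (rename_back f (single m' c)) m = lookup 0 m"
    by (simp add: lookup_rename_back lookup_single)
qed

text \<open>A product of two monomials contains a variable outside the range of \<open>f\<close> if and only if one
  of the factors does; in this case both sides vanish.\<close>

lemma rename_back_mult: "rename_back f (p * q) = rename_back f p * rename_back f q"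
proof (rule multiplicative_on_monomials_imp_multiplicative)
  fix a b :: "'b \<Rightarrow>\<^sub>0 nat" and c d :: 'c
  show "rename_back f (single a c * single b d) = rename_back f (single a c) * rename_back f (single b d)"
  proof (cases "keys a \<subseteq> range f \<and> keys b \<subseteq> range f")
    case True
    then obtain a' b' where "a = rename_exponent f a'" "b = rename_exponent f b'"
      by (metis rename_exponent_surj)
    then show ?thesis
      by (simp add: mult_single rename_exponent_add[symmetric] rename_back_single)
  next
    case False
    have "rename_back f (single a c) = 0 \<or> rename_back f (single b d) = 0"
      using False rename_back_single_outside by blast
    moreover have "\<not> keys (a + b) \<subseteq> range f" using False unfolding keys_add_exponents by blast
    then have "rename_back f (single (a + b) (c * d)) = 0" by (rule rename_back_single_outside)
    ultimately show ?thesis by (auto simp: mult_single)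
  qed
qed (rule rename_back_add)

lemma rename_back_iso:
  "cring_iso (polynomial_ring (f ` V)) (polynomial_ring V) (rename_back f :: _ \<Rightarrow> (_ \<Rightarrow>\<^sub>0 'k::field))"
proof -
  let ?P = "polynomial_ring (f ` V) :: (('b \<Rightarrow>\<^sub>0 nat) \<Rightarrow>\<^sub>0 'k) ring"
  have closed: "rename_back f p \<in> carrier (polynomial_ring V)" if p: "p \<in> carrier ?P"
    for p :: "('b \<Rightarrow>\<^sub>0 nat) \<Rightarrow>\<^sub>0 'k"
    unfolding polynomial_ring_carrier
  proof
    fix m assume "m \<in> keys (rename_back f p)"
    then have "rename_exponent f m \<in> keys p" by (simp add: in_keys_iff lookup_rename_back)
    then have "f ` keys m \<subseteq> f ` V"
      using p unfolding polynomial_ring_carrier by (auto simp flip: keys_rename_exponent)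
    then show "keys m \<subseteq> V" using inj_image_subset_iff[OF f] by blast
  qed
  have bij: "bij_betw (rename_back f) (carrier ?P) (carrier (polynomial_ring V))"
    unfolding bij_betw_def
  proof
    show "inj_on (rename_back f) (carrier ?P)"
    proof (rule inj_onI, rule poly_mapping_eqI)
      fix p q :: "('b \<Rightarrow>\<^sub>0 nat) \<Rightarrow>\<^sub>0 'k" and m'
      assume pq: "p \<in> carrier ?P" "q \<in> carrier ?P" "rename_back f p = rename_back f q"
      show "lookup p m' = lookup q m'"
      proof (cases "keys m' \<subseteq> range f")
        case True
        then obtain m where "m' = rename_exponent f m" by (rule rename_exponent_surj)
        then show ?thesis using pq(3) lookup_rename_back by metis
      next
        case False
        then have "m' \<notin> keys p" "m' \<notin> keys q"
          using pq(1,2) unfolding polynomial_ring_carrier by blast+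
        then show ?thesis by (simp add: in_keys_iff)
      qed
    qed
    show "rename_back f ` carrier ?P = carrier (polynomial_ring V)"
    proof (intro equalityI subsetI)
      fix p :: "('a \<Rightarrow>\<^sub>0 nat) \<Rightarrow>\<^sub>0 'k" assume p: "p \<in> carrier (polynomial_ring V)"
      define p' where "p' = (\<Sum>m\<in>keys p. single (rename_exponent f m) (lookup p m))"
      have sum: "rename_back f (sum g A) = (\<Sum>m\<in>A. rename_back f (g m))"
        for g :: "('a \<Rightarrow>\<^sub>0 nat) \<Rightarrow> (('b \<Rightarrow>\<^sub>0 nat) \<Rightarrow>\<^sub>0 'k)" and A
        by (induction A rule: infinite_finite_induct)
          (simp_all add: rename_back_add, simp_all add: rename_back_def inj_rename_exponent)
      have "rename_back f p' = p"
        unfolding p'_def sum rename_back_single by (rule poly_mapping_sum_single[symmetric])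
      moreover have "p' \<in> carrier ?P"
        unfolding polynomial_ring_carrier
      proof
        fix m' assume "m' \<in> keys p'"
        then obtain m where "m \<in> keys p" "m' \<in> keys (single (rename_exponent f m) (lookup p m))"
          unfolding p'_def by (blast dest: subsetD[OF keys_sum])
        then show "keys m' \<subseteq> f ` V"
          using p unfolding polynomial_ring_carrier
          by (auto simp: keys_rename_exponent split: if_splits)
      qed
      ultimately show "p \<in> rename_back f ` carrier ?P" by blast
    next
      fix p :: "('a \<Rightarrow>\<^sub>0 nat) \<Rightarrow>\<^sub>0 'k" assume "p \<in> rename_back f ` carrier ?P"
      then show "p \<in> carrier (polynomial_ring V)" using closed by blast
    qed
  qed
  have "rename_exponent f 0 = 0" by (simp add: rename_exponent_def)
  then have "rename_back f (1 :: ('b \<Rightarrow>\<^sub>0 nat) \<Rightarrow>\<^sub>0 'k) = 1"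
    using rename_back_single[of 0 1] by simp
  then show ?thesis
    using closed bij
    by (intro cring_iso.intro cring_iso_axioms.intro cring_polynomial_ring ring_iso_memI)
      (simp_all add: rename_back_mult rename_back_add)
qed

text \<open>This makes the two Stanley--Reisner ideals correspond under the isomorphism of the polynomial
  rings.\<close>

lemma rename_back_nonface_monomials:
  assumes "finite V"
  shows "rename_back f ` nonface_monomials (f ` V) ((`) f ` \<Delta>) =
    (nonface_monomials V \<Delta> :: (_ \<Rightarrow>\<^sub>0 'k::field) set)"
proof -
  have sq: "rename_back f (squarefree_monomial (f ` F)) = (squarefree_monomial F :: _ \<Rightarrow>\<^sub>0 'k)"
    if "F \<subseteq> V" for F
    unfolding squarefree_monomial_def rename_exponent_squarefree[OF finite_subset[OF that assms], symmetric]
    by (rule rename_back_single)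
  let ?A = "{F. F \<subseteq> V \<and> F \<notin> \<Delta>}"
  have "{F. F \<subseteq> f ` V \<and> F \<notin> (`) f ` \<Delta>} = (`) f ` ?A"
  proof (intro equalityI subsetI)
    fix F assume "F \<in> {F. F \<subseteq> f ` V \<and> F \<notin> (`) f ` \<Delta>}"
    then obtain F' where "F' \<subseteq> V" "F = f ` F'" "F \<notin> (`) f ` \<Delta>" by (auto simp: subset_image_iff)
    then show "F \<in> (`) f ` ?A" by blast
  next
    fix F assume "F \<in> (`) f ` ?A"
    then show "F \<in> {F. F \<subseteq> f ` V \<and> F \<notin> (`) f ` \<Delta>}"
      by (auto simp: inj_image_eq_iff[OF f])
  qed
  then have "rename_back f ` nonface_monomials (f ` V) ((`) f ` \<Delta>) =
      (\<lambda>F. rename_back f (squarefree_monomial (f ` F)) :: _ \<Rightarrow>\<^sub>0 'k) ` ?A"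
    unfolding nonface_monomials_def setcompr_eq_image by (simp only: image_image)
  also have "\<dots> = squarefree_monomial ` ?A"
    by (intro image_cong refl sq) simp
  finally show ?thesis unfolding nonface_monomials_def setcompr_eq_image .
qed

theorem cohen_macaulay_stanley_reisner_rename:
  assumes V: "finite V"
    and cm: "cohen_macaulay_ring (stanley_reisner_ring V \<Delta> :: (('a \<Rightarrow>\<^sub>0 nat) \<Rightarrow>\<^sub>0 'k::field) set ring)"
  shows "cohen_macaulay_ring
    (stanley_reisner_ring (f ` V) ((`) f ` \<Delta>) :: (('b \<Rightarrow>\<^sub>0 nat) \<Rightarrow>\<^sub>0 'k) set ring)"
proof -
  let ?P = "polynomial_ring (f ` V) :: (('b \<Rightarrow>\<^sub>0 nat) \<Rightarrow>\<^sub>0 'k) ring"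
  let ?Q = "polynomial_ring V :: (('a \<Rightarrow>\<^sub>0 nat) \<Rightarrow>\<^sub>0 'k) ring"
  let ?N = "nonface_monomials (f ` V) ((`) f ` \<Delta>) :: (('b \<Rightarrow>\<^sub>0 nat) \<Rightarrow>\<^sub>0 'k) set"
  let ?M = "nonface_monomials V \<Delta> :: (('a \<Rightarrow>\<^sub>0 nat) \<Rightarrow>\<^sub>0 'k) set"
  interpret cring_iso ?P ?Q "rename_back f" by (rule rename_back_iso)
  have N: "?N \<subseteq> carrier ?P" using V by (intro nonface_monomials_subset) simp
  have "rename_back f ` genideal ?P ?N = genideal ?Q ?M"
    unfolding genideal_image[OF N, symmetric] rename_back_nonface_monomials[OF V] ..
  then have iso: "(stanley_reisner_ring (f ` V) ((`) f ` \<Delta>) :: (('b \<Rightarrow>\<^sub>0 nat) \<Rightarrow>\<^sub>0 'k) set ring) \<simeq>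
      (stanley_reisner_ring V \<Delta> :: (('a \<Rightarrow>\<^sub>0 nat) \<Rightarrow>\<^sub>0 'k) set ring)"
    using quotient_iso[OF R.genideal_ideal[OF N]] unfolding stanley_reisner_ring_eq by simp
  have cr: "cring (stanley_reisner_ring (f ` V) ((`) f ` \<Delta>) :: (('b \<Rightarrow>\<^sub>0 nat) \<Rightarrow>\<^sub>0 'k) set ring)"
    using V by (intro cring_stanley_reisner_ring) simp
  have "(stanley_reisner_ring V \<Delta> :: (('a \<Rightarrow>\<^sub>0 nat) \<Rightarrow>\<^sub>0 'k) set ring) \<simeq>
      (stanley_reisner_ring (f ` V) ((`) f ` \<Delta>) :: (('b \<Rightarrow>\<^sub>0 nat) \<Rightarrow>\<^sub>0 'k) set ring)"
    by (rule ring_iso_sym[OF cring.axioms(1)[OF cr] iso])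
  then show ?thesis
    by (rule cohen_macaulay_ring_iso[OF cring_stanley_reisner_ring[OF V] cr _ cm])
qed

end

section \<open>Lexicographic products over a complete graph\<close>

lemma complete_graph_adjacent_iff:
  assumes "complete_graph G"
  shows "(u, v) \<in> parcs G \<longleftrightarrow> u \<in> pverts G \<and> v \<in> pverts G \<and> u \<noteq> v"
  using assms unfolding complete_graph_def complete_digraph_def
  by (auto simp: arcs_ends_def arc_to_ends_def)

lemma nonempty_graphD:
  assumes "nonempty_graph G"
  shows "finite (pverts G)" "pverts G \<noteq> {}" "(u, u) \<notin> parcs G"
proof -
  interpret pair_graph G using assms by (simp add: nonempty_graph_def)
  show "finite (pverts G)" by (rule pair_finite_verts)
  show "pverts G \<noteq> {}" using assms by (simp add: nonempty_graph_def)
  show "(u, u) \<notin> parcs G" using pair_no_loops[of "(u, u)"] by auto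
qed

lemma independence_number_ge:
  assumes "finite (pverts G)" "independent_set G S"
  shows "card S \<le> independence_number G"
proof -
  have "{S. independent_set G S} \<subseteq> Pow (pverts G)" by (auto simp: independent_set_def)
  then have "finite (card ` {S. independent_set G S})" using assms(1) finite_subset by blast
  then show ?thesis using assms(2) unfolding independence_number_def by (intro Max_ge) auto
qed

lemma independence_number_complete:
  assumes "nonempty_graph G" "complete_graph G"
  shows "independence_number G \<le> 1"
proof -
  have "card S \<le> 1" if "independent_set G S" for S
  proof -
    have "u = v" if "u \<in> S" "v \<in> S" for u v
      using \<open>independent_set G S\<close> that complete_graph_adjacent_iff[OF assms(2), of u v]
      unfolding independent_set_def by blast
    moreover have "finite S"
      using that finite_subset nonempty_graphD(1)[OF assms(1)] by (auto simp: independent_set_def)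
    ultimately show ?thesis using card_le_Suc0_iff_eq[of S] by simp
  qed
  moreover have "independent_set G {}" by (simp add: independent_set_def)
  moreover have "finite {S. independent_set G S}"
    using finite_subset[of _ "Pow (pverts G)"] nonempty_graphD(1)[OF assms(1)]
    by (auto simp: independent_set_def)
  ultimately show ?thesis
    unfolding independence_number_def by (subst Max_le_iff) auto
qed

lemma adjacent_if_independence_number_le_one:
  assumes "nonempty_graph G" "independence_number G \<le> 1" "u \<in> pverts G" "v \<in> pverts G" "u \<noteq> v"
  shows "(u, v) \<in> parcs G \<or> (v, u) \<in> parcs G"
proof (rule ccontr)
  assume "\<not> ?thesis"
  then have "independent_set G {u, v}"
    using assms(3,4) nonempty_graphD(3)[OF assms(1)] by (auto simp: independent_set_def)
  then have "card {u, v} \<le> 1"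
    using independence_number_ge[OF nonempty_graphD(1)[OF assms(1)]] assms(2) by (meson order_trans)
  then show False using assms(5) by simp
qed

lemma pverts_lex_product: "pverts (lex_product G H) = (SIGMA x : pverts G. pverts (H x))"
  by (simp add: lex_product_def Let_def)

lemma parcs_lex_product:
  "((x, y), (x', y')) \<in> parcs (lex_product G H) \<longleftrightarrow>
    x \<in> pverts G \<and> y \<in> pverts (H x) \<and> x' \<in> pverts G \<and> y' \<in> pverts (H x') \<and>
    (x = x' \<and> (y, y') \<in> parcs (H x) \<or> (x, x') \<in> parcs G)"
  by (auto simp: lex_product_def Let_def)

text \<open>Independent sets in such a graph have at most one element, so the independence complex
  consists of isolated points.\<close>

lemma cohen_macaulay_graph_if_adjacent:
  assumes fin: "finite (pverts G)" and ne: "pverts G \<noteq> {}"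
    and loopfree: "\<And>u. (u, u) \<notin> parcs G"
    and adj: "\<And>u v. u \<in> pverts G \<Longrightarrow> v \<in> pverts G \<Longrightarrow> u \<noteq> v \<Longrightarrow> (u, v) \<in> parcs G \<or> (v, u) \<in> parcs G"
  shows "cohen_macaulay_graph TYPE('k::field) G"
  unfolding cohen_macaulay_graph_def
proof (rule cohen_macaulay_stanley_reisner_points[OF fin ne])
  fix F assume F: "F \<subseteq> pverts G"
  have "(\<forall>u\<in>F. \<forall>v\<in>F. (u, v) \<notin> parcs G) \<longleftrightarrow> (\<forall>u\<in>F. \<forall>v\<in>F. u = v)"
  proof (intro iffI ballI)
    fix u v assume indep: "\<forall>u\<in>F. \<forall>v\<in>F. (u, v) \<notin> parcs G" and uv: "u \<in> F" "v \<in> F"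
    show "u = v"
      using adj[of u v] F uv indep by (meson subsetD)
  next
    fix u v assume "\<forall>u\<in>F. \<forall>v\<in>F. u = v" "u \<in> F" "v \<in> F"
    then have "u = v" by simp
    then show "(u, v) \<notin> parcs G" using loopfree by simp
  qed
  then show "F \<in> independence_complex G \<longleftrightarrow> (\<forall>u\<in>F. \<forall>v\<in>F. u = v)"
    using F by (simp add: independence_complex_def independent_set_def)
qed

lemma independence_complex_lex_product_singleton:
  assumes "pverts G = {x}" "(x, x) \<notin> parcs G"
  shows "independence_complex (lex_product G H) = (`) (Pair x) ` independence_complex (H x)"
proof -
  have V: "pverts (lex_product G H) = Pair x ` pverts (H x)"
    using assms(1) by (auto simp: pverts_lex_product)
  have indep: "independent_set (lex_product G H) (Pair x ` T) \<longleftrightarrow> independent_set (H x) T"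
    if "T \<subseteq> pverts (H x)" for T
  proof -
    have "((x, u), (x, v)) \<in> parcs (lex_product G H) \<longleftrightarrow> (u, v) \<in> parcs (H x)" if "u \<in> T" "v \<in> T" for u v
      using \<open>T \<subseteq> _\<close> that assms unfolding parcs_lex_product by blast
    then show ?thesis
      using \<open>T \<subseteq> _\<close> unfolding independent_set_def V by blast
  qed
  show ?thesis
    unfolding independence_complex_def
  proof (intro equalityI subsetI)
    fix S assume S: "S \<in> {S. independent_set (lex_product G H) S}"
    then have "S \<subseteq> Pair x ` pverts (H x)" by (simp add: independent_set_def V)
    then obtain T where T: "T \<subseteq> pverts (H x)" "S = Pair x ` T" by (rule subset_imageE)
    then have "independent_set (H x) T" using S indep[OF T(1)] by simp
    then show "S \<in> (`) (Pair x) ` {T. independent_set (H x) T}" using T(2) by simp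
  next
    fix S assume "S \<in> (`) (Pair x) ` {T. independent_set (H x) T}"
    then obtain T where T: "independent_set (H x) T" "S = Pair x ` T" by auto
    then have "T \<subseteq> pverts (H x)" by (simp add: independent_set_def)
    then show "S \<in> {S. independent_set (lex_product G H) S}" using T indep by simp
  qed
qed

theorem corollary2p17:
  fixes G :: "'a pair_pre_digraph"
    and H :: "'a \<Rightarrow> 'b pair_pre_digraph"
    and n :: nat
  assumes "nonempty_graph G"
    and "complete_graph G"
    and "card (pverts G) = n"
    and "\<And>x. x \<in> pverts G \<Longrightarrow> nonempty_graph (H x)"
    and "\<And>x. x \<in> pverts G \<Longrightarrow> cohen_macaulay_graph TYPE('k::field) (H x)"
    and "\<And>x. x \<in> pverts G \<Longrightarrow> shellable_graph (H x)"
    and "card {x \<in> pverts G. complete_graph (H x)} \<ge> n - 1"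
    and "\<And>x y. x \<in> pverts G \<Longrightarrow> y \<in> pverts G \<Longrightarrow>
           independence_number (H x) = independence_number (H y)"
  shows "cohen_macaulay_graph TYPE('k) (lex_product G H)"
proof (cases "n = 1")
  case True
  then obtain x where x: "pverts G = {x}" using assms(3) card_1_singletonE by metis
  then have cm: "cohen_macaulay_graph TYPE('k) (H x)" and fin: "finite (pverts (H x))"
    using assms(5) nonempty_graphD(1)[OF assms(4)] by simp_all
  have V: "pverts (lex_product G H) = Pair x ` pverts (H x)"
    using x by (auto simp: pverts_lex_product)
  have C: "independence_complex (lex_product G H) = (`) (Pair x) ` independence_complex (H x)"
    using x nonempty_graphD(3)[OF assms(1)] by (rule independence_complex_lex_product_singleton)
  have "inj (Pair x :: 'b \<Rightarrow> 'a \<times> 'b)" by (rule injI) simp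
  then show ?thesis
    using fin cm unfolding cohen_macaulay_graph_def V C by (rule cohen_macaulay_stanley_reisner_rename)
next
  case False
  have G: "finite (pverts G)" "pverts G \<noteq> {}" using nonempty_graphD[OF assms(1)] by blast+
  then have "n \<noteq> 0" using assms(3) by auto
  with False assms(7) have "card {x \<in> pverts G. complete_graph (H x)} \<noteq> 0" by linarith
  then have "{x \<in> pverts G. complete_graph (H x)} \<noteq> {}" by (metis card.empty)
  then obtain z where z: "z \<in> pverts G" "complete_graph (H z)" by blast
  have le: "independence_number (H x) \<le> 1" if "x \<in> pverts G" for x
    using independence_number_complete[OF assms(4)[OF z(1)] z(2)] assms(8)[OF that z(1)] by simp
  show ?thesis
  proof (rule cohen_macaulay_graph_if_adjacent)
    show "finite (pverts (lex_product G H))"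
      unfolding pverts_lex_product by (intro finite_SigmaI G(1) nonempty_graphD(1)[OF assms(4)])
    show "pverts (lex_product G H) \<noteq> {}"
      unfolding pverts_lex_product using z(1) nonempty_graphD(2)[OF assms(4)[OF z(1)]] by blast
  next
    fix p show "(p, p) \<notin> parcs (lex_product G H)"
    proof (cases p)
      case (Pair x y)
      show ?thesis
        unfolding Pair parcs_lex_product
        using nonempty_graphD(3)[OF assms(1), of x] nonempty_graphD(3)[OF assms(4), of x y] by simp
    qed
  next
    fix p q assume pq: "p \<in> pverts (lex_product G H)" "q \<in> pverts (lex_product G H)" "p \<noteq> q"
    obtain x y x' y' where eq: "p = (x, y)" "q = (x', y')" by (cases p, cases q)
    have xy: "x \<in> pverts G" "y \<in> pverts (H x)" "x' \<in> pverts G" "y' \<in> pverts (H x')"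
      using pq(1,2) by (simp_all add: eq pverts_lex_product)
    show "(p, q) \<in> parcs (lex_product G H) \<or> (q, p) \<in> parcs (lex_product G H)"
    proof (cases "x = x'")
      case True
      then have "y \<noteq> y'" "y' \<in> pverts (H x)" using pq(3) eq xy(4) by simp_all
      then have "(y, y') \<in> parcs (H x) \<or> (y', y) \<in> parcs (H x)"
        using adjacent_if_independence_number_le_one[OF assms(4)[OF xy(1)] le[OF xy(1)] xy(2)] by blast
      with xy \<open>y' \<in> pverts (H x)\<close> show ?thesis by (auto simp: eq parcs_lex_product True[symmetric])
    next
      case False
      then have "(x, x') \<in> parcs G"
        by (simp add: complete_graph_adjacent_iff[OF assms(2)] xy)
      then show ?thesis by (simp add: eq parcs_lex_product xy)
    qed
  qed
qed

end
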